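(* Let $\mathscr{H}$ and $\mathscr{U}$ be complex Hilbert spaces, $\mathbb{T}$ a strongly continuous semigroup on $\mathscr{H}$ with generator $\mathcal{A}$, $\mathcal{B}$ an admissible control operator for $\mathbb{T}$, $T>0$, $x_0,x_T\in\mathscr{H}$, $U\subseteq L^2((0,T);\mathscr{U})$ a closed convex set, $\theta\colon\mathscr{H}\times\mathscr{U}\times[0,T]\to\mathbb{R}$, and $g_j\colon\mathscr{H}\times[0,T]\to\mathbb{R}$, $j\in J=\{1,\dots,l\}$. Consider $$\min_{(x,u)}\ \mathcal{I}(x,u)=\int_0^T\theta(x(t),u(t),t)\,dt\quad\text{subject to}\quad\dot x(t)=\mathcal{A}x(t)+\mathcal{B}u(t),\ t\in[0,T],$$ $$x(0)=x_0,\ x(T)=x_T,\ u\in U,\quad g_j(x(t),t)\le0\ \ \forall t\in[0,T],\ j\in J.\qquad(\ast)$$ Let $X=C([0,T];\mathscr{H})\times L^2((0,T);\mathscr{U})$ and let $A$ be the set of all $(x,u)\in X$ with $u\in U$, $x(T)=x_T$ and $x(t)=\mathbb{T}_tx_0+F_tu$ for all $t\in[0,T]$. Suppose that: 1. $\theta$ is continuous, and for any $R>0$ there exist $C_R>0$ and an a.e. nonnegative $\omega_R\in L^1(0,T)$ such that $|\theta(x,u,t)|\le C_R\|u\|_{\mathscr{U}}^2+\omega_R(t)$ for all $x\in\mathscr{H}$, $u\in\mathscr{U}$, $t\in(0,T)$ with $\|x\|_{\mathscr{H}}\le R$; 2. there exists a globally optimal solution of $(\ast)$; 3. the functions $g_j(x,t)$,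 $j\in J$, are convex in $x$ and continuous jointly in $x$ and $t$, and Slater's condition holds: there exists $(\widehat{x},\widehat{u})\in A$ such that $g_j(\widehat{x}(t),t)<0$ for all $t\in[0,T]$ and $j\in J$; 4. the function $(x,u)\mapsto\theta(x,u,t)$ is convex for any $t\in[0,T]$; 5. for some $1\le p<+\infty$ there exist Lagrange multipliers $(\mu_1,\dots,\mu_l)$ corresponding to the state constraints of $(\ast)$ such that the Borel measures $\mu_j$ are absolutely continuous with respect to the Lebesgue measure, and their Radon–Nikodym derivatives belong to $L^{p'}[0,T]$, where $1/p+1/p'=1$. Then there exists $\lambda^*\ge0$ such that for any $\lambda\ge\lambda^*$ the penalty function $$\Phi_\lambda(x,u)=\mathcal{I}(x,u)+\lambda\sum_{j=1}^l\Big(\int_0^T\max\{g_j(x(t),t),0\}^p\,dt\Big)^{1/p}$$ for problem $(\ast)$ is completely exact on $A$.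
   Context: Control system: let $\mathscr{H}_{-1}$ be the extrapolation space of $\mathscr{H}$ (completion of $\mathscr{H}$ in the norm $\|(\beta I-\mathcal{A})^{-1}\cdot\|$, $\beta$ in the resolvent set of $\mathcal{A}$), to which $\mathbb{T}$ extends. A bounded linear $\mathcal{B}\colon\mathscr{U}\to\mathscr{H}_{-1}$ is an admissible control operator for $\mathbb{T}$ if for some $\tau>0$ the map $F_\tau u=\int_0^\tau\mathbb{T}_{\tau-\sigma}\mathcal{B}u(\sigma)\,d\sigma$ takes values in $\mathscr{H}$ for all $u\in L^2((0,\infty);\mathscr{U})$. Then for each $t\ge0$ the input map $F_tu=\int_0^t\mathbb{T}_{t-\sigma}\mathcal{B}u(\sigma)\,d\sigma$ is a bounded operator into $\mathscr{H}$, and for $u\in L^2((0,T);\mathscr{U})$ the unique solution in $C([0,T];\mathscr{H})$ of $\dot x=\mathcal{A}x+\mathcal{B}u$, $x(0)=x_0$ is $x(t)=\mathbb{T}_tx_0+F_tu$. $L^2((0,T);\mathscr{U})$ has its standard norm; $X$ carries the sum norm. Lagrange multipliers: let $(x^*,u^* )$ be a globally optimal solution of $(\ast)$. A collection $(\mu_1,\dots,\mu_l)$ of (nonnegative) regular Borel measures on $[0,T]$ is called Lagrange multipliers corresponding to the state constraints of $(\ast)$ if $\mathcal{I}(x,u)+\sum_{j=1}^l\int_{[0,T]}g_j(x(t),t)\,d\mu_j(t)\ge\mathcal{I}(x^*,u^* )$ for all $(x,u)\in A$. $\Omega=\{(x,u)\in A\mid g_j(x(t),t)\le0\ \forall t\in[0,T],\,j\in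 J\}$ is the feasible set of $(\ast)$. For $K\subseteq X$, $f\colon X\to\mathbb{R}$ and $z\in K$, $f^{\downarrow}_K(z)=\liminf_{y\to z,\,y\in K}\frac{f(y)-f(z)}{\|y-z\|_X}$ ($+\infty$ if $z$ is isolated in $K$); $z$ is an inf-stationary point of $f$ on $K$ if $f^{\downarrow}_K(z)\ge0$. For a given $\lambda$, $\Phi_\lambda$ is completely exact on $A$ if: (1) the optimal values of $\min_\Omega\mathcal{I}$ and $\min_A\Phi_\lambda$ coincide; (2) their globally optimal solutions coincide; (3) $z\in A$ is a locally optimal solution of $\min_A\Phi_\lambda$ iff $z\in\Omega$ and $z$ is a locally optimal solution of $\min_\Omega\mathcal{I}$; (4) $z\in A$ is an inf-stationary point of $\Phi_\lambda$ on $A$ iff $z\in\Omega$ and $z$ is an inf-stationary point of $\mathcal{I}$ on $\Omega$. Local optimality is with respect to the norm of $X$. *)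

theory Defs
  imports "HOL-Analysis.Analysis"
begin

section \<open>Complex normed spaces and complex Hilbert spaces\<close>

class complex_normed_vector = real_normed_vector +
  fixes scaleC :: "complex \<Rightarrow> 'a \<Rightarrow> 'a" (infixr "*\<^sub>C" 75)
  assumes scaleC_add_right: "a *\<^sub>C (x + y) = a *\<^sub>C x + a *\<^sub>C y"
    and scaleC_add_left: "(a + b) *\<^sub>C x = a *\<^sub>C x + b *\<^sub>C x"
    and scaleC_scaleC: "a *\<^sub>C (b *\<^sub>C x) = (a * b) *\<^sub>C x"
    and scaleC_of_real: "complex_of_real r *\<^sub>C x = r *\<^sub>R x"
    and norm_scaleC: "norm (a *\<^sub>C x) = cmod a * norm x"

class complex_banach = complex_normed_vector + complete_space

text \<open>The inherited real inner product is the real part of the complex one, so the norm is the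
  one induced by the complex inner product. No separability is assumed.\<close>

class complex_hilbert = complex_banach + real_inner +
  fixes cinner :: "'a \<Rightarrow> 'a \<Rightarrow> complex"
  assumes cinner_commute: "cinner x y = cnj (cinner y x)"
    and cinner_add_left: "cinner (x + y) z = cinner x z + cinner y z"
    and cinner_scaleC_left: "cinner (a *\<^sub>C x) y = a * cinner x y"
    and Re_cinner: "Re (cinner x y) = inner x y"

definition bounded_clinear ::
    "('a::complex_normed_vector \<Rightarrow> 'b::complex_normed_vector) \<Rightarrow> bool" where
  "bounded_clinear f \<longleftrightarrow> bounded_linear f \<and> (\<forall>c x. f (c *\<^sub>C x) = c *\<^sub>C f x)"


section \<open>Bochner integration without separability\<close>

text \<open>The library's Bochner integral is restricted to second countable spaces. The following
  definitions are the usual ones for an arbitrary normed space, built from the library's simple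
  functions, with strong measurability in place of Borel measurability.\<close>

definition strongly_measurable :: "'a measure \<Rightarrow> ('a \<Rightarrow> 'b::real_normed_vector) \<Rightarrow> bool" where
  "strongly_measurable M f \<longleftrightarrow>
     (\<exists>s. (\<forall>i::nat. simple_function M (s i)) \<and> (AE x in M. (\<lambda>i. s i x) \<longlonglongrightarrow> f x))"

definition has_bochner :: "'a measure \<Rightarrow> ('a \<Rightarrow> 'b::real_normed_vector) \<Rightarrow> 'b \<Rightarrow> bool" where
  "has_bochner M f I \<longleftrightarrow> strongly_measurable M f \<and>
     (\<exists>s. (\<forall>i::nat. Bochner_Integration.simple_bochner_integrable M (s i)) \<and>
          (\<lambda>i. \<integral>\<^sup>+x. ennreal (norm (f x - s i x)) \<partial>M) \<longlonglongrightarrow> 0 \<and>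
          (\<lambda>i. Bochner_Integration.simple_bochner_integral M (s i)) \<longlonglongrightarrow> I)"

definition bochner :: "'a measure \<Rightarrow> ('a \<Rightarrow> 'b::real_normed_vector) \<Rightarrow> 'b" where
  "bochner M f = (if \<exists>I. has_bochner M f I then THE I. has_bochner M f I else 0)"


section \<open>Function spaces\<close>

text \<open>Elements of Lebesgue spaces are given by representatives, and elements of
  \<open>C([0,T]; H)\<close> by functions on the line whose values outside \<open>[0,T]\<close> are irrelevant. All notions
  below (closedness, neighbourhoods, local optimality, lower limits) only use the resulting
  seminorms; in particular a set of representatives that is closed for the \<open>L\<^sup>2\<close> seminorm
  is automatically saturated for equality almost everywhere.\<close>

definition L2 :: "real set \<Rightarrow> (real \<Rightarrow> 'u::real_normed_vector) set" where
  "L2 S = {u. strongly_measurable (lebesgue_on S) u \<and>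
              integrable (lebesgue_on S) (\<lambda>t. (norm (u t))\<^sup>2)}"

definition norm_L2 :: "real \<Rightarrow> (real \<Rightarrow> 'u::real_normed_vector) \<Rightarrow> real" where
  "norm_L2 T u = sqrt (LINT t|lebesgue_on {0<..<T}. (norm (u t))\<^sup>2)"

definition norm_C :: "real \<Rightarrow> (real \<Rightarrow> 'h::real_normed_vector) \<Rightarrow> real" where
  "norm_C T x = (SUP t\<in>{0..T}. norm (x t))"

definition dist_X :: "real \<Rightarrow> (real \<Rightarrow> 'h::real_normed_vector) \<times> (real \<Rightarrow> 'u::real_normed_vector)
    \<Rightarrow> (real \<Rightarrow> 'h) \<times> (real \<Rightarrow> 'u) \<Rightarrow> real" where
  "dist_X T = (\<lambda>(x, u) (y, v). norm_C T (\<lambda>t. x t - y t) + norm_L2 T (\<lambda>t. u t - v t))"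

definition closed_L2 :: "real \<Rightarrow> (real \<Rightarrow> 'u::real_normed_vector) set \<Rightarrow> bool" where
  "closed_L2 T U \<longleftrightarrow>
     (\<forall>u\<in>L2 {0<..<T}. (\<forall>e>0. \<exists>v\<in>U. norm_L2 T (\<lambda>t. u t - v t) < e) \<longrightarrow> u \<in> U)"

definition convex_functions :: "(real \<Rightarrow> 'u::real_vector) set \<Rightarrow> bool" where
  "convex_functions U \<longleftrightarrow>
     (\<forall>u\<in>U. \<forall>v\<in>U. \<forall>a. 0 \<le> a \<and> a \<le> 1 \<longrightarrow> (\<lambda>t. (1 - a) *\<^sub>R u t + a *\<^sub>R v t) \<in> U)"

definition mem_Lp :: "ennreal \<Rightarrow> 'a measure \<Rightarrow> ('a \<Rightarrow> real) \<Rightarrow> bool" where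
  "mem_Lp q M f \<longleftrightarrow> f \<in> borel_measurable M \<and>
     (if q = \<infinity> then \<exists>C. AE x in M. \<bar>f x\<bar> \<le> C
      else integrable M (\<lambda>x. \<bar>f x\<bar> powr enn2real q))"


section \<open>Semigroups, extrapolation spaces and admissible control operators\<close>

definition C0_semigroup :: "(real \<Rightarrow> 'h::complex_banach \<Rightarrow> 'h) \<Rightarrow> bool" where
  "C0_semigroup S \<longleftrightarrow>
     (\<forall>t\<ge>0. bounded_clinear (S t)) \<and>
     (\<forall>x. S 0 x = x) \<and>
     (\<forall>s\<ge>0. \<forall>t\<ge>0. \<forall>x. S (s + t) x = S s (S t x)) \<and>
     (\<forall>x. continuous_on {0..} (\<lambda>t. S t x))"

definition is_generator_value :: "(real \<Rightarrow> 'h::complex_banach \<Rightarrow> 'h) \<Rightarrow> 'h \<Rightarrow> 'h \<Rightarrow> bool" where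
  "is_generator_value S x y \<longleftrightarrow> ((\<lambda>t. (1 / t) *\<^sub>R (S t x - x)) \<longlongrightarrow> y) (at_right 0)"

definition generator_domain :: "(real \<Rightarrow> 'h::complex_banach \<Rightarrow> 'h) \<Rightarrow> 'h set" where
  "generator_domain S = {x. \<exists>y. is_generator_value S x y}"

definition generator :: "(real \<Rightarrow> 'h::complex_banach \<Rightarrow> 'h) \<Rightarrow> 'h \<Rightarrow> 'h" where
  "generator S x = (THE y. is_generator_value S x y)"

definition resolvent :: "(real \<Rightarrow> 'h::complex_banach \<Rightarrow> 'h) \<Rightarrow> complex \<Rightarrow> 'h \<Rightarrow> 'h" where
  "resolvent S \<beta> = the_inv_into (generator_domain S) (\<lambda>x. \<beta> *\<^sub>C x - generator S x)"

definition resolvent_set :: "(real \<Rightarrow> 'h::complex_banach \<Rightarrow> 'h) \<Rightarrow> complex set" where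
  "resolvent_set S =
     {\<beta>. bij_betw (\<lambda>x. \<beta> *\<^sub>C x - generator S x) (generator_domain S) UNIV \<and>
          bounded_clinear (resolvent S \<beta>)}"

text \<open>The type \<open>'e\<close>, together with the embedding \<open>\<iota>\<close>, is a completion of \<open>'h\<close> in the
  norm \<open>norm (resolvent S \<beta> x)\<close>. Completions are unique up to isometric isomorphism.\<close>

definition extrapolation_space :: "(real \<Rightarrow> 'h::complex_hilbert \<Rightarrow> 'h) \<Rightarrow> complex \<Rightarrow>
    ('h \<Rightarrow> 'e::complex_banach) \<Rightarrow> bool" where
  "extrapolation_space S \<beta> \<iota> \<longleftrightarrow>
     \<beta> \<in> resolvent_set S \<and>
     (\<forall>x y. \<iota> (x + y) = \<iota> x + \<iota> y) \<and> (\<forall>c x. \<iota> (c *\<^sub>C x) = c *\<^sub>C \<iota> x) \<and>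
     (\<forall>x. norm (\<iota> x) = norm (resolvent S \<beta> x)) \<and>
     closure (range \<iota>) = UNIV"

definition extended_semigroup :: "(real \<Rightarrow> 'h::complex_hilbert \<Rightarrow> 'h) \<Rightarrow>
    ('h \<Rightarrow> 'e::complex_banach) \<Rightarrow> real \<Rightarrow> 'e \<Rightarrow> 'e" where
  "extended_semigroup S \<iota> t = (THE E. bounded_linear E \<and> (\<forall>x. E (\<iota> x) = \<iota> (S t x)))"

definition input_map :: "(real \<Rightarrow> 'h::complex_hilbert \<Rightarrow> 'h) \<Rightarrow> ('h \<Rightarrow> 'e::complex_banach) \<Rightarrow>
    ('u::complex_hilbert \<Rightarrow> 'e) \<Rightarrow> real \<Rightarrow> (real \<Rightarrow> 'u) \<Rightarrow> 'e" where
  "input_map S \<iota> B t u =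
     bochner (lebesgue_on {0<..<t}) (\<lambda>\<sigma>. extended_semigroup S \<iota> (t - \<sigma>) (B (u \<sigma>)))"

definition admissible_control :: "(real \<Rightarrow> 'h::complex_hilbert \<Rightarrow> 'h) \<Rightarrow>
    ('h \<Rightarrow> 'e::complex_banach) \<Rightarrow> ('u::complex_hilbert \<Rightarrow> 'e) \<Rightarrow> bool" where
  "admissible_control S \<iota> B \<longleftrightarrow> bounded_clinear B \<and>
     (\<exists>\<tau>>0. \<forall>u\<in>L2 {0<..}. input_map S \<iota> B \<tau> u \<in> range \<iota>)"


section \<open>Optimisation\<close>

definition global_solutions :: "('z \<Rightarrow> real) \<Rightarrow> 'z set \<Rightarrow> 'z set" where
  "global_solutions f K = {z\<in>K. \<forall>y\<in>K. f z \<le> f y}"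

definition optimal_value :: "('z \<Rightarrow> real) \<Rightarrow> 'z set \<Rightarrow> ereal" where
  "optimal_value f K = (INF z\<in>K. ereal (f z))"

definition local_solution :: "('z \<Rightarrow> 'z \<Rightarrow> real) \<Rightarrow> ('z \<Rightarrow> real) \<Rightarrow> 'z set \<Rightarrow> 'z \<Rightarrow> bool" where
  "local_solution d f K z \<longleftrightarrow> z \<in> K \<and> (\<exists>\<delta>>0. \<forall>y\<in>K. d y z < \<delta> \<longrightarrow> f z \<le> f y)"

text \<open>The lower limit over points \<open>y \<in> K\<close> at nonzero distance from \<open>z\<close>. If \<open>z\<close> is isolated in \<open>K\<close>,
  the filter is trivial and the lower limit is \<open>\<infinity>\<close>.\<close>

definition rate_of_steepest_descent ::
    "('z \<Rightarrow> 'z \<Rightarrow> real) \<Rightarrow> ('z \<Rightarrow> real) \<Rightarrow> 'z set \<Rightarrow> 'z \<Rightarrow> ereal" where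
  "rate_of_steepest_descent d f K z =
     Liminf (INF \<delta>\<in>{0<..}. principal {y\<in>K. 0 < d y z \<and> d y z < \<delta>})
       (\<lambda>y. ereal ((f y - f z) / d y z))"

definition inf_stationary :: "('z \<Rightarrow> 'z \<Rightarrow> real) \<Rightarrow> ('z \<Rightarrow> real) \<Rightarrow> 'z set \<Rightarrow> 'z \<Rightarrow> bool" where
  "inf_stationary d f K z \<longleftrightarrow> z \<in> K \<and> 0 \<le> rate_of_steepest_descent d f K z"

definition completely_exact ::
    "('z \<Rightarrow> 'z \<Rightarrow> real) \<Rightarrow> ('z \<Rightarrow> real) \<Rightarrow> 'z set \<Rightarrow> ('z \<Rightarrow> real) \<Rightarrow> 'z set \<Rightarrow> bool" where
  "completely_exact d \<I> \<Omega> \<Phi> A \<longleftrightarrow>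
     optimal_value \<I> \<Omega> = optimal_value \<Phi> A \<and>
     global_solutions \<I> \<Omega> = global_solutions \<Phi> A \<and>
     (\<forall>z\<in>A. local_solution d \<Phi> A z \<longleftrightarrow> z \<in> \<Omega> \<and> local_solution d \<I> \<Omega> z) \<and>
     (\<forall>z\<in>A. inf_stationary d \<Phi> A z \<longleftrightarrow> z \<in> \<Omega> \<and> inf_stationary d \<I> \<Omega> z)"


section \<open>The optimal control problem\<close>

text \<open>The equation \<open>x(t) = S\<^sub>t x\<^sub>0 + F\<^sub>t u\<close> is stated in the extrapolation space, in
  which \<open>'h\<close> is embedded by \<open>\<iota>\<close>.\<close>

definition admissible_pairs :: "(real \<Rightarrow> 'h::complex_hilbert \<Rightarrow> 'h) \<Rightarrow> ('h \<Rightarrow> 'e::complex_banach) \<Rightarrow>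
    ('u::complex_hilbert \<Rightarrow> 'e) \<Rightarrow> real \<Rightarrow> 'h \<Rightarrow> 'h \<Rightarrow> (real \<Rightarrow> 'u) set \<Rightarrow>
    ((real \<Rightarrow> 'h) \<times> (real \<Rightarrow> 'u)) set" where
  "admissible_pairs S \<iota> B T x0 xT U =
     {(x, u). continuous_on {0..T} x \<and> u \<in> L2 {0<..<T} \<and> u \<in> U \<and> x T = xT \<and>
        (\<forall>t\<in>{0..T}. \<iota> (x t) = \<iota> (S t x0) + input_map S \<iota> B t u)}"

definition feasible_pairs :: "real \<Rightarrow> nat \<Rightarrow> (nat \<Rightarrow> 'h \<Rightarrow> real \<Rightarrow> real) \<Rightarrow>
    ((real \<Rightarrow> 'h) \<times> (real \<Rightarrow> 'u)) set \<Rightarrow> ((real \<Rightarrow> 'h) \<times> (real \<Rightarrow> 'u)) set" where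
  "feasible_pairs T l g A = {(x, u)\<in>A. \<forall>t\<in>{0..T}. \<forall>j\<in>{1..l}. g j (x t) t \<le> 0}"

definition objective :: "real \<Rightarrow> ('h \<Rightarrow> 'u \<Rightarrow> real \<Rightarrow> real) \<Rightarrow> (real \<Rightarrow> 'h) \<times> (real \<Rightarrow> 'u) \<Rightarrow> real" where
  "objective T \<theta> = (\<lambda>(x, u). LINT t|lebesgue_on {0<..<T}. \<theta> (x t) (u t) t)"

definition penalty_function :: "real \<Rightarrow> ('h \<Rightarrow> 'u \<Rightarrow> real \<Rightarrow> real) \<Rightarrow> nat \<Rightarrow>
    (nat \<Rightarrow> 'h \<Rightarrow> real \<Rightarrow> real) \<Rightarrow> real \<Rightarrow> real \<Rightarrow> (real \<Rightarrow> 'h) \<times> (real \<Rightarrow> 'u) \<Rightarrow> real" where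
  "penalty_function T \<theta> l g p c = (\<lambda>(x, u). objective T \<theta> (x, u) +
     c * (\<Sum>j=1..l. (LINT t|lebesgue_on {0<..<T}. (max (g j (x t) t) 0) powr p) powr (1 / p)))"

definition regular_borel_measure_on :: "real set \<Rightarrow> real measure \<Rightarrow> bool" where
  "regular_borel_measure_on K \<mu> \<longleftrightarrow>
     sets \<mu> = sets (restrict_space borel K) \<and> finite_measure \<mu> \<and>
     (\<forall>E\<in>sets \<mu>. emeasure \<mu> E = (INF V\<in>{V. openin (top_of_set K) V \<and> E \<subseteq> V}. emeasure \<mu> V) \<and>
                 emeasure \<mu> E = (SUP C\<in>{C. compact C \<and> C \<subseteq> E}. emeasure \<mu> C))"

definition lagrange_multipliers :: "real \<Rightarrow> ('h \<Rightarrow> 'u \<Rightarrow> real \<Rightarrow> real) \<Rightarrow> nat \<Rightarrow>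
    (nat \<Rightarrow> 'h \<Rightarrow> real \<Rightarrow> real) \<Rightarrow> ((real \<Rightarrow> 'h) \<times> (real \<Rightarrow> 'u)) set \<Rightarrow>
    (real \<Rightarrow> 'h) \<times> (real \<Rightarrow> 'u) \<Rightarrow> (nat \<Rightarrow> real measure) \<Rightarrow> bool" where
  "lagrange_multipliers T \<theta> l g A zs \<mu> \<longleftrightarrow>
     (\<forall>j\<in>{1..l}. regular_borel_measure_on {0..T} (\<mu> j)) \<and>
     (\<forall>(x, u)\<in>A. objective T \<theta> (x, u) + (\<Sum>j=1..l. LINT t|\<mu> j. g j (x t) t) \<ge> objective T \<theta> zs)"

end

theory Submission
  imports Defs
begin

text \<open>Everything reduces to convexity. The input map is linear, so the set \<open>A\<close> is convex, and both
  \<open>\<I>\<close> and the penalty term (a sum of \<open>L\<^sup>p\<close> norms of positive parts) are convex on it; for a convex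
  function on a convex set, local minimizers and inf-stationary points are global minimizers. It
  remains to compare global minimizers, and there Hoelder's inequality bounds the multiplier term
  \<open>\<integral> g\<^sub>j(x(t), t) d\<mu>\<^sub>j\<close> by a constant times the \<open>j\<close>-th \<open>L\<^sup>p\<close> norm, which gives a threshold for \<open>\<lambda>\<close>.

  Linearity of the input map is not for free, because \<^const>\<open>bochner\<close> is \<open>0\<close> on functions
  that are not integrable: the integrand \<open>\<T>\<^sub>t\<^sub>-\<^sub>\<sigma> B u(\<sigma>)\<close> has to be shown strongly measurable and
  bounded in norm by a multiple of \<open>\<parallel>u(\<sigma>)\<parallel>\<close>, uniformly in \<open>\<sigma>\<close>.\<close>

section \<open>Local and global minimizers of convex functions\<close>

text \<open>With the multiplier constants alone as weight, the penalty function is bounded below on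
  \<open>A\<close> by the optimal value, but an infeasible pair might still attain it. Any larger
  weight makes the inequality strict off \<open>\<Omega>\<close>: by continuity, a constraint
  violated at a single instant already has a positive \<open>L^p\<close> penalty. This strictness is
  what identifies the global minimizers on \<open>A\<close> with those on \<open>\<Omega>\<close>.
  The uniform bound on the integrand of the input map rests on a commutation. The extrapolation norm
  of a vector is the norm of its resolvent, and the semigroup commutes with the resolvent. Hence a
  bound for \<open>S t\<close> on \<open>{0..T}\<close>, which the uniform boundedness principle
  supplies, survives in the extension with the same constant. The Hilbert spaces may be
  nonseparable, so measurability is always traced back to simple functions. Their limits exist only
  almost everywhere, and completeness of the restricted Lebesgue measure absorbs the exceptional
  null sets.\<close>

text \<open>What remains of convexity when the points of a segment are known only through their values and
  distances. The distance may be a seminorm, hence the condition on points at distance zero.\<close>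

definition segmentwise_convex :: "('z \<Rightarrow> 'z \<Rightarrow> real) \<Rightarrow> ('z \<Rightarrow> real) \<Rightarrow> 'z set \<Rightarrow> bool" where
  "segmentwise_convex d f K \<longleftrightarrow>
     (\<forall>z\<in>K. \<forall>y\<in>K. 0 \<le> d y z \<and> (d y z = 0 \<longrightarrow> f y = f z) \<and>
        (\<forall>a. 0 < a \<and> a < 1 \<longrightarrow> (\<exists>w\<in>K. d w z \<le> a * d y z \<and> f w \<le> (1 - a) * f z + a * f y)))"

text \<open>Moving from \<open>z\<close> a fraction \<open>a\<close> of the way to \<open>y\<close>
  keeps at least the fraction \<open>a\<close> of the drop in value and at most the fraction
  \<open>a\<close> of the distance. So the slope towards \<open>y\<close> is not lost on approaching
  \<open>z\<close>.\<close>

lemma segmentwise_convex_descent: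
  assumes conv: "segmentwise_convex d f K" and "z \<in> K" "y \<in> K" "f y < f z" "0 < \<delta>"
  obtains w where "w \<in> K" "0 < d w z" "d w z < \<delta>" "f w < f z"
    "(f w - f z) / d w z \<le> (f y - f z) / d y z"
proof -
  have D: "d y z > 0"
    using conv assms(2-4) unfolding segmentwise_convex_def by (metis less_irrefl order_le_less)
  \<comment> \<open>The bound 1/2 keeps \<open>a\<close> below 1; the factor 2 in the other term
    leaves \<open>a * d y z\<close> at most half of \<open>\<delta>\<close>, hence strictly below
    it.\<close>
  define a where "a = min (1/2) (\<delta> / (2 * d y z))"
  have a: "0 < a" "a < 1" "a * d y z < \<delta>"
    using D \<open>0 < \<delta>\<close> by (auto simp: a_def min_def field_simps)
  obtain w where w: "w \<in> K" "d w z \<le> a * d y z" "f w \<le> (1 - a) * f z + a * f y"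
    using conv assms(2,3) a unfolding segmentwise_convex_def by blast
  have le: "f w - f z \<le> a * (f y - f z)"
    using w(3) by (simp add: algebra_simps)
  have neg: "a * (f y - f z) < 0"
    using a assms(4) by (simp add: mult_pos_neg)
  have dw: "0 < d w z"
    using conv w(1) assms(2) le neg unfolding segmentwise_convex_def
    by (metis diff_self less_irrefl order_le_less order_le_less_trans)
  have "(f w - f z) / d w z \<le> a * (f y - f z) / d w z"
    using le dw by (simp add: divide_right_mono)
  \<comment> \<open>The numerator is negative, so enlarging the denominator enlarges the
    quotient.\<close>
  also have "\<dots> \<le> a * (f y - f z) / (a * d y z)"
    using neg dw w(2) D a by (intro divide_left_mono_neg) auto
  also have "\<dots> = (f y - f z) / d y z"
    using a by simp
  finally show thesis
    using that[of w] w a le neg dw by linarith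
qed

lemma local_solution_iff_global:
  assumes "segmentwise_convex d f K" "z \<in> K"
  shows "local_solution d f K z \<longleftrightarrow> z \<in> global_solutions f K"
proof
  assume "local_solution d f K z"
  then obtain \<delta> where \<delta>: "\<delta> > 0" "\<forall>y\<in>K. d y z < \<delta> \<longrightarrow> f z \<le> f y"
    unfolding local_solution_def by blast
  have "f z \<le> f y" if "y \<in> K" for y
    using segmentwise_convex_descent[OF assms that _ \<delta>(1)] \<delta>(2) by (metis not_le)
  then show "z \<in> global_solutions f K"
    using assms(2) by (simp add: global_solutions_def)
qed (auto simp: local_solution_def global_solutions_def intro: exI[of _ 1])

text \<open>A strictly better point \<open>y\<close> produces points arbitrarily close to
  \<open>z\<close> whose difference quotients stay below one fixed negative number, which is
  incompatible with a nonnegative lower limit.\<close>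

lemma inf_stationary_iff_global:
  assumes "segmentwise_convex d f K" "z \<in> K"
  shows "inf_stationary d f K z \<longleftrightarrow> z \<in> global_solutions f K"
proof -
  let ?F = "INF \<delta>\<in>{0<..}. principal {y\<in>K. 0 < d y z \<and> d y z < \<delta>}"
  have ev: "eventually P ?F \<longleftrightarrow> (\<exists>\<delta>>0. \<forall>y\<in>K. 0 < d y z \<longrightarrow> d y z < \<delta> \<longrightarrow> P y)" for P
  proof (subst eventually_INF_base)
    fix a b :: real assume "a \<in> {0<..}" "b \<in> {0<..}"
    then show "\<exists>x\<in>{0<..}. principal {y\<in>K. 0 < d y z \<and> d y z < x} \<le>
        inf (principal {y\<in>K. 0 < d y z \<and> d y z < a}) (principal {y\<in>K. 0 < d y z \<and> d y z < b})"
      by (intro bexI[of _ "min a b"]) auto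
  qed (auto simp: eventually_principal Bex_def)
  show ?thesis
  proof
    assume "inf_stationary d f K z"
    then have L: "eventually (\<lambda>y. r < ereal ((f y - f z) / d y z)) ?F" if "r < 0" for r
      using that unfolding inf_stationary_def rate_of_steepest_descent_def le_Liminf_iff by blast
    have "f z \<le> f y" if y: "y \<in> K" for y
    proof (rule ccontr)
      assume "\<not> f z \<le> f y"
      then have fy: "f y < f z" by simp
      have "d y z > 0"
        using assms y fy unfolding segmentwise_convex_def by (metis less_irrefl order_le_less)
      \<comment> \<open>The slope towards \<open>y\<close> itself serves as the level for the lower
        limit: near \<open>z\<close> all slopes would exceed it strictly, while descent gives one
        that does not.\<close>
      then have "ereal ((f y - f z) / d y z) < 0"
        using fy by (simp add: divide_neg_pos)
      from L[OF this] obtain \<delta> where \<delta>: "\<delta> > 0"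
        "\<And>w. w \<in> K \<Longrightarrow> 0 < d w z \<Longrightarrow> d w z < \<delta> \<Longrightarrow> (f y - f z) / d y z < (f w - f z) / d w z"
        unfolding ev by auto
      show False
        using segmentwise_convex_descent[OF assms y fy \<delta>(1)] \<delta>(2) by (metis not_le)
    qed
    then show "z \<in> global_solutions f K"
      using assms(2) by (simp add: global_solutions_def)
  next
    assume "z \<in> global_solutions f K"
    then have min: "f z \<le> f y" if "y \<in> K" for y
      using that by (auto simp: global_solutions_def)
    have "0 \<le> Liminf ?F (\<lambda>y. ereal ((f y - f z) / d y z))"
      unfolding le_Liminf_iff ev
    proof (intro allI impI exI[of _ 1] conjI ballI)
      fix r :: ereal and y assume "r < 0" "y \<in> K" "0 < d y z"
      then have "ereal ((f y - f z) / d y z) \<ge> 0"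
        using min by simp
      then show "r < ereal ((f y - f z) / d y z)"
        using \<open>r < 0\<close> by (rule order_less_le_trans[rotated])
    qed simp
    then show "inf_stationary d f K z"
      using assms(2) by (simp add: inf_stationary_def rate_of_steepest_descent_def)
  qed
qed

text \<open>Convexity turns local minimality and inf-stationarity into global minimality on either
  set, so all four requirements reduce to comparing global minimizers. The strict inequality in
  \<open>lower\<close> keeps minimizers of \<open>\<Phi>\<close> out of \<open>A - \<Omega>\<close>;
  on \<open>\<Omega>\<close> both functions agree.\<close>

lemma completely_exactI:
  assumes sub: "\<Omega> \<subseteq> A" and eq: "\<And>z. z \<in> \<Omega> \<Longrightarrow> \<Phi> z = \<I> z"
    and conv: "segmentwise_convex d \<Phi> A" "segmentwise_convex d \<I> \<Omega>"
    and opt: "zs \<in> global_solutions \<I> \<Omega>"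
    and lower: "\<And>z. z \<in> A - \<Omega> \<Longrightarrow> \<I> zs < \<Phi> z"
  shows "completely_exact d \<I> \<Omega> \<Phi> A"
proof -
  have zs: "zs \<in> \<Omega>" and min: "\<And>z. z \<in> \<Omega> \<Longrightarrow> \<I> zs \<le> \<I> z"
    using opt by (auto simp: global_solutions_def)
  have low: "\<I> zs \<le> \<Phi> z" if "z \<in> A" for z
    using that lower[of z] min[of z] eq[of z] by (cases "z \<in> \<Omega>") auto
  have vI: "optimal_value \<I> \<Omega> = ereal (\<I> zs)"
    unfolding optimal_value_def using zs min by (intro antisym INF_lower INF_greatest) auto
  have v\<Phi>: "optimal_value \<Phi> A = ereal (\<I> zs)"
    unfolding optimal_value_def using zs sub low eq[OF zs]
    by (intro antisym INF_greatest) (auto intro!: INF_lower2[of zs])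
  have glob: "global_solutions \<I> \<Omega> = global_solutions \<Phi> A"
  proof (intro equalityI subsetI)
    fix z assume "z \<in> global_solutions \<I> \<Omega>"
    then have "z \<in> \<Omega>" "\<I> z \<le> \<I> zs" using zs by (auto simp: global_solutions_def)
    then show "z \<in> global_solutions \<Phi> A"
      using sub eq low by (force simp: global_solutions_def)
  next
    fix z assume z: "z \<in> global_solutions \<Phi> A"
    then have "\<Phi> z \<le> \<I> zs" "z \<in> A" using zs sub eq by (force simp: global_solutions_def)+
    then have "z \<in> \<Omega>" using lower[of z] by force
    with z sub eq show "z \<in> global_solutions \<I> \<Omega>"
      by (force simp: global_solutions_def)
  qed
  have "z \<in> global_solutions \<Phi> A \<longleftrightarrow> z \<in> \<Omega> \<and> z \<in> global_solutions \<I> \<Omega>" for z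
    unfolding glob[symmetric] by (auto simp: global_solutions_def)
  then show ?thesis
    unfolding completely_exact_def vI v\<Phi>
    using glob local_solution_iff_global[OF conv(1)] local_solution_iff_global[OF conv(2)]
      inf_stationary_iff_global[OF conv(1)] inf_stationary_iff_global[OF conv(2)]
    by blast
qed

section \<open>Strong measurability and the Bochner integral\<close>

text \<open>Preimages under \<open>f\<close> and \<open>g\<close> differ by a subset of a null set,
  which is measurable by completeness.\<close>

lemma (in complete_measure) borel_measurable_eq_AE:
  assumes f: "f \<in> borel_measurable M" and ae: "AE x in M. f x = g x"
  shows "g \<in> borel_measurable M"
proof (rule measurableI)
  fix A :: "'b set" assume A: "A \<in> sets borel"
  show "g -` A \<inter> space M \<in> sets M"
  proof (rule in_sets_AE)
    show "f -` A \<inter> space M \<in> sets M" using f A by (rule measurable_sets)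
    show "AE x in M. x \<in> f -` A \<inter> space M \<longleftrightarrow> x \<in> g -` A \<inter> space M"
      using ae by eventually_elim auto
  qed auto
qed auto

text \<open>Measurability in \<open>x\<close> for fixed \<open>c\<close> suffices along a simple
  function, and continuity in \<open>c\<close> carries it to the limit. The lemma serves both the
  norm of a strongly measurable function and the integrand \<open>\<theta>\<close> along a
  trajectory.\<close>

lemma (in complete_measure) borel_measurable_Caratheodory:
  fixes h :: "'a \<Rightarrow> 'b::real_normed_vector \<Rightarrow> real"
  assumes f: "strongly_measurable M f"
    and h: "\<And>c. (\<lambda>x. h x c) \<in> borel_measurable M"
    and cont: "\<And>x. x \<in> space M \<Longrightarrow> continuous_on UNIV (h x)"
  shows "(\<lambda>x. h x (f x)) \<in> borel_measurable M"
proof -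
  obtain s where s: "\<And>i::nat. simple_function M (s i)" "AE x in M. (\<lambda>i. s i x) \<longlonglongrightarrow> f x"
    using f by (auto simp: strongly_measurable_def)
  \<comment> \<open>The simple function has finitely many values, so the composition is pieced
    together from finitely many functions with \<open>c\<close> fixed.\<close>
  have sm: "(\<lambda>x. h x (s i x)) \<in> borel_measurable M" for i
  proof (rule measurable_compose_countable'[where f="\<lambda>c x. h x c" and g="s i"])
    show "s i \<in> measurable M (count_space (s i ` space M))"
      by (rule measurableI) (use simple_functionD(2)[OF s(1)] in auto)
    show "countable (s i ` space M)"
      using s(1)[of i] by (auto simp: simple_function_def intro: countable_finite)
  qed (rule h)
  \<comment> \<open>Where the sequence diverges, \<open>lim\<close> is an arbitrary value; this
    affects a null set only.\<close>
  have "(\<lambda>x. lim (\<lambda>i. h x (s i x))) \<in> borel_measurable M"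
    using sm by measurable
  moreover have "AE x in M. lim (\<lambda>i. h x (s i x)) = h x (f x)"
    using s(2) AE_space
  proof eventually_elim
    case (elim x)
    have "isCont (h x) (f x)"
      using cont[OF elim(2)] by (simp add: continuous_on_eq_continuous_at)
    then have "(\<lambda>i. h x (s i x)) \<longlonglongrightarrow> h x (f x)"
      using elim(1) by (rule isCont_tendsto_compose)
    then show ?case by (rule limI)
  qed
  ultimately show ?thesis by (rule borel_measurable_eq_AE)
qed

lemma (in complete_measure) borel_measurable_norm_strongly_measurable:
  assumes "strongly_measurable M f"
  shows "(\<lambda>x. norm (f x)) \<in> borel_measurable M"
  using assms by (rule borel_measurable_Caratheodory) (auto intro: continuous_on_norm continuous_on_id)

lemma strongly_measurable_simple_function:
  "simple_function M f \<Longrightarrow> strongly_measurable M f"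
  unfolding strongly_measurable_def by (intro exI[of _ "\<lambda>_. f"]) auto

lemma strongly_measurable_combine:
  assumes "strongly_measurable M f" "strongly_measurable M g"
  shows "strongly_measurable M (\<lambda>x. a *\<^sub>R f x + b *\<^sub>R g x)"
proof -
  obtain s t where s: "\<And>i::nat. simple_function M (s i)" "AE x in M. (\<lambda>i. s i x) \<longlonglongrightarrow> f x"
    and t: "\<And>i::nat. simple_function M (t i)" "AE x in M. (\<lambda>i. t i x) \<longlonglongrightarrow> g x"
    using assms by (auto simp: strongly_measurable_def)
  show ?thesis
    unfolding strongly_measurable_def
  proof (intro exI conjI allI)
    show "simple_function M (\<lambda>x. a *\<^sub>R s i x + b *\<^sub>R t i x)" for i
      using s(1) t(1) by (rule simple_function_compose2)
    show "AE x in M. (\<lambda>i. a *\<^sub>R s i x + b *\<^sub>R t i x) \<longlonglongrightarrow> a *\<^sub>R f x + b *\<^sub>R g x"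
      using s(2) t(2) by eventually_elim (intro tendsto_intros)
  qed
qed

lemma strongly_measurable_diff:
  assumes "strongly_measurable M f" "strongly_measurable M g"
  shows "strongly_measurable M (\<lambda>x. f x - g x)"
  using strongly_measurable_combine[OF assms, of 1 "-1"] by simp

lemma strongly_measurable_mono:
  assumes f: "strongly_measurable (lebesgue_on S) f" and "R \<subseteq> S" "R \<in> sets lebesgue" "S \<in> sets lebesgue"
  shows "strongly_measurable (lebesgue_on R) f"
proof -
  obtain s where s: "\<And>i::nat. simple_function (lebesgue_on S) (s i)"
      "AE x in lebesgue_on S. (\<lambda>i. s i x) \<longlonglongrightarrow> f x"
    using f by (auto simp: strongly_measurable_def)
  have "simple_function (lebesgue_on R) (s i)" for i
    using s(1)[of i] measurable_restrict_mono[OF _ assms(2), of "s i" lebesgue "count_space UNIV"]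
      finite_subset[OF image_mono[OF assms(2)], of "s i"]
    unfolding simple_function_eq_measurable space_lebesgue_on by blast
  moreover have "AE x in lebesgue_on R. (\<lambda>i. s i x) \<longlonglongrightarrow> f x"
    using s(2) assms(2-4) by (auto simp: AE_restrict_space_iff)
  ultimately show ?thesis unfolding strongly_measurable_def by blast
qed

lemma complete_measure_lebesgue_on:
  assumes "S \<in> sets lebesgue"
  shows "complete_measure (lebesgue_on S)"
proof
  fix A B assume "B \<subseteq> A" "A \<in> null_sets (lebesgue_on S)"
  then show "B \<in> sets (lebesgue_on S)"
    using assms completion.complete2[of B A] by (auto simp: null_sets_restrict_space sets_restrict_space_iff)
qed


section \<open>Uniqueness, linearity and existence of the Bochner integral\<close>

lemma (in complete_measure) borel_measurable_norm_diff_simple_function: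
  assumes "strongly_measurable M f" "simple_function M s"
  shows "(\<lambda>x. norm (f x - s x)) \<in> borel_measurable M"
  by (intro borel_measurable_norm_strongly_measurable strongly_measurable_diff assms
      strongly_measurable_simple_function)

text \<open>The integral of a simple function is 1-Lipschitz in the \<open>L^1\<close> distance, and
  \<open>f\<close> is inserted by the triangle inequality. With two approximating sequences this
  gives uniqueness of the integral, with one sequence the Cauchy property.\<close>

lemma (in complete_measure) simple_bochner_integral_dist:
  assumes f: "strongly_measurable M f"
    and s: "Bochner_Integration.simple_bochner_integrable M s"
    and t: "Bochner_Integration.simple_bochner_integrable M t"
  shows "ennreal (norm (Bochner_Integration.simple_bochner_integral M s -
      Bochner_Integration.simple_bochner_integral M t)) \<le>
    (\<integral>\<^sup>+x. norm (f x - s x) \<partial>M) + (\<integral>\<^sup>+x. norm (f x - t x) \<partial>M)"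
    (is "ennreal (norm (?s - ?t)) \<le> ?S + ?T")
proof -
  have sm: "simple_function M s" "simple_function M t"
    using s t by (auto elim: simple_bochner_integrable.cases)
  have [measurable]: "(\<lambda>x. norm (f x - s x)) \<in> borel_measurable M"
      "(\<lambda>x. norm (f x - t x)) \<in> borel_measurable M"
    by (rule borel_measurable_norm_diff_simple_function[OF f sm(1)], rule borel_measurable_norm_diff_simple_function[OF f sm(2)])
  have "norm (?s - ?t) = norm (Bochner_Integration.simple_bochner_integral M (\<lambda>x. s x - t x))"
    using s t by (subst simple_bochner_integral_diff) auto
  also have "\<dots> \<le> Bochner_Integration.simple_bochner_integral M (\<lambda>x. norm (s x - t x))"
    using simple_bochner_integrable_compose2[of "(-)" M "s" "t"] s t
    by (auto intro!: simple_bochner_integral_norm_bound)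
  finally have "ennreal (norm (?s - ?t)) \<le>
      ennreal (Bochner_Integration.simple_bochner_integral M (\<lambda>x. norm (s x - t x)))"
    by (rule ennreal_leI)
  also have "\<dots> = (\<integral>\<^sup>+x. norm (s x - t x) \<partial>M)"
    using simple_bochner_integrable_compose2[of "\<lambda>x y. norm (x - y)" M "s" "t"] s t
    by (auto intro!: simple_bochner_integral_eq_nn_integral)
  also have "\<dots> \<le> (\<integral>\<^sup>+x. ennreal (norm (f x - s x)) + ennreal (norm (f x - t x)) \<partial>M)"
    by (intro nn_integral_mono)
      (metis ennreal_leI ennreal_plus norm_ge_zero norm_minus_commute norm_diff_triangle_le order_refl)
  also have "\<dots> = ?S + ?T"
    by (rule nn_integral_add) auto
  finally show ?thesis .
qed

text \<open>Independence of the approximating sequence is what makes the \<open>THE\<close> in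
  \<open>bochner\<close> meaningful.\<close>

lemma (in complete_measure) has_bochner_unique:
  assumes "has_bochner M f I" "has_bochner M f J"
  shows "I = J"
proof -
  obtain s t where f: "strongly_measurable M f"
    and s: "\<And>i::nat. Bochner_Integration.simple_bochner_integrable M (s i)"
      "(\<lambda>i. \<integral>\<^sup>+x. ennreal (norm (f x - s i x)) \<partial>M) \<longlonglongrightarrow> 0"
      "(\<lambda>i. Bochner_Integration.simple_bochner_integral M (s i)) \<longlonglongrightarrow> I"
    and t: "\<And>i::nat. Bochner_Integration.simple_bochner_integrable M (t i)"
      "(\<lambda>i. \<integral>\<^sup>+x. ennreal (norm (f x - t i x)) \<partial>M) \<longlonglongrightarrow> 0"
      "(\<lambda>i. Bochner_Integration.simple_bochner_integral M (t i)) \<longlonglongrightarrow> J"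
    using assms unfolding has_bochner_def by (elim conjE exE) blast
  let ?d = "\<lambda>i. norm (Bochner_Integration.simple_bochner_integral M (s i) -
      Bochner_Integration.simple_bochner_integral M (t i))"
  have "(\<lambda>i. ennreal (?d i)) \<longlonglongrightarrow> 0"
  proof (rule tendsto_sandwich[where f="\<lambda>_. 0"])
    show "\<forall>\<^sub>F i in sequentially. ennreal (?d i) \<le>
        (\<integral>\<^sup>+x. norm (f x - s i x) \<partial>M) + (\<integral>\<^sup>+x. norm (f x - t i x) \<partial>M)"
      using simple_bochner_integral_dist[OF f s(1) t(1)] by simp
    show "(\<lambda>i. (\<integral>\<^sup>+x. norm (f x - s i x) \<partial>M) + (\<integral>\<^sup>+x. norm (f x - t i x) \<partial>M)) \<longlonglongrightarrow> 0"
      using tendsto_add[OF s(2) t(2)] by simp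
  qed simp_all
  moreover have "(\<lambda>i. ennreal (?d i)) \<longlonglongrightarrow> ennreal (norm (I - J))"
    using s(3) t(3) by (intro tendsto_ennrealI tendsto_intros)
  ultimately have "ennreal (norm (I - J)) = 0"
    using LIMSEQ_unique by blast
  then show ?thesis by simp
qed

lemma (in complete_measure) bochner_eq:
  "has_bochner M f I \<Longrightarrow> bochner M f = I"
  unfolding bochner_def
  by (subst if_P, blast) (rule the_equality, assumption, erule has_bochner_unique)

lemma (in complete_measure) has_bochner_combine:
  assumes "has_bochner M f I" "has_bochner M g J"
  shows "has_bochner M (\<lambda>x. a *\<^sub>R f x + b *\<^sub>R g x) (a *\<^sub>R I + b *\<^sub>R J)"
proof -
  obtain s t where f: "strongly_measurable M f" and g: "strongly_measurable M g"
    and s: "\<And>i::nat. Bochner_Integration.simple_bochner_integrable M (s i)"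
      "(\<lambda>i. \<integral>\<^sup>+x. ennreal (norm (f x - s i x)) \<partial>M) \<longlonglongrightarrow> 0"
      "(\<lambda>i. Bochner_Integration.simple_bochner_integral M (s i)) \<longlonglongrightarrow> I"
    and t: "\<And>i::nat. Bochner_Integration.simple_bochner_integrable M (t i)"
      "(\<lambda>i. \<integral>\<^sup>+x. ennreal (norm (g x - t i x)) \<partial>M) \<longlonglongrightarrow> 0"
      "(\<lambda>i. Bochner_Integration.simple_bochner_integral M (t i)) \<longlonglongrightarrow> J"
    using assms unfolding has_bochner_def by (elim conjE exE) blast
  have sm: "simple_function M (s i)" "simple_function M (t i)" for i
    using s(1)[of i] t(1)[of i] by (auto elim: simple_bochner_integrable.cases)
  have [measurable]: "(\<lambda>x. norm (f x - s i x)) \<in> borel_measurable M"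
      "(\<lambda>x. norm (g x - t i x)) \<in> borel_measurable M" for i
    by (rule borel_measurable_norm_diff_simple_function[OF f sm(1)], rule borel_measurable_norm_diff_simple_function[OF g sm(2)])
  have sa: "Bochner_Integration.simple_bochner_integrable M (\<lambda>x. a *\<^sub>R s i x)"
    and tb: "Bochner_Integration.simple_bochner_integrable M (\<lambda>x. b *\<^sub>R t i x)" for i
    using simple_bochner_integrable_compose2[of "\<lambda>x y. a *\<^sub>R x", OF _ s(1) s(1)]
      simple_bochner_integrable_compose2[of "\<lambda>x y. b *\<^sub>R x", OF _ t(1) t(1)] by auto
  have int: "Bochner_Integration.simple_bochner_integral M (\<lambda>x. a *\<^sub>R s i x + b *\<^sub>R t i x) =
      a *\<^sub>R Bochner_Integration.simple_bochner_integral M (s i) +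
      b *\<^sub>R Bochner_Integration.simple_bochner_integral M (t i)" for i
    using simple_bochner_integral_add[OF sa tb]
      simple_bochner_integral_linear[OF linear_scaleR s(1)]
      simple_bochner_integral_linear[OF linear_scaleR t(1)] by simp
  show ?thesis
    unfolding has_bochner_def
  proof (intro conjI exI[of _ "\<lambda>i x. a *\<^sub>R s i x + b *\<^sub>R t i x"] allI)
    show "strongly_measurable M (\<lambda>x. a *\<^sub>R f x + b *\<^sub>R g x)"
      using f g by (rule strongly_measurable_combine)
    show "Bochner_Integration.simple_bochner_integrable M (\<lambda>x. a *\<^sub>R s i x + b *\<^sub>R t i x)" for i
      using simple_bochner_integrable_compose2[of "(+)", OF _ sa tb] by simp
    show "(\<lambda>i. Bochner_Integration.simple_bochner_integral M (\<lambda>x. a *\<^sub>R s i x + b *\<^sub>R t i x))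
        \<longlonglongrightarrow> a *\<^sub>R I + b *\<^sub>R J"
      unfolding int using s(3) t(3) by (intro tendsto_intros)
    let ?h = "\<lambda>i. \<integral>\<^sup>+x. norm (a *\<^sub>R f x + b *\<^sub>R g x - (a *\<^sub>R s i x + b *\<^sub>R t i x)) \<partial>M"
    show "?h \<longlonglongrightarrow> 0"
    proof (rule tendsto_sandwich[where f="\<lambda>_. 0"])
      show "\<forall>\<^sub>F i in sequentially. ?h i \<le> ennreal \<bar>a\<bar> * (\<integral>\<^sup>+x. norm (f x - s i x) \<partial>M)
          + ennreal \<bar>b\<bar> * (\<integral>\<^sup>+x. norm (g x - t i x) \<partial>M)"
      proof (intro always_eventually allI)
        fix i
        have "?h i \<le> (\<integral>\<^sup>+x. ennreal \<bar>a\<bar> * norm (f x - s i x) + ennreal \<bar>b\<bar> * norm (g x - t i x) \<partial>M)"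
        proof (intro nn_integral_mono)
          fix x
          have "a *\<^sub>R f x + b *\<^sub>R g x - (a *\<^sub>R s i x + b *\<^sub>R t i x) =
              a *\<^sub>R (f x - s i x) + b *\<^sub>R (g x - t i x)"
            by (simp add: algebra_simps)
          then have "norm (a *\<^sub>R f x + b *\<^sub>R g x - (a *\<^sub>R s i x + b *\<^sub>R t i x)) \<le>
              \<bar>a\<bar> * norm (f x - s i x) + \<bar>b\<bar> * norm (g x - t i x)"
            using norm_triangle_ineq[of "a *\<^sub>R (f x - s i x)" "b *\<^sub>R (g x - t i x)"] by simp
          then show "ennreal (norm (a *\<^sub>R f x + b *\<^sub>R g x - (a *\<^sub>R s i x + b *\<^sub>R t i x))) \<le>
              ennreal \<bar>a\<bar> * norm (f x - s i x) + ennreal \<bar>b\<bar> * norm (g x - t i x)"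
            by (simp add: ennreal_leI flip: ennreal_mult ennreal_plus)
        qed
        also have "\<dots> = ennreal \<bar>a\<bar> * (\<integral>\<^sup>+x. norm (f x - s i x) \<partial>M)
          + ennreal \<bar>b\<bar> * (\<integral>\<^sup>+x. norm (g x - t i x) \<partial>M)"
          by (simp add: nn_integral_add nn_integral_cmult)
        finally show "?h i \<le> \<dots>" .
      qed
      show "(\<lambda>i. ennreal \<bar>a\<bar> * (\<integral>\<^sup>+x. norm (f x - s i x) \<partial>M)
          + ennreal \<bar>b\<bar> * (\<integral>\<^sup>+x. norm (g x - t i x) \<partial>M)) \<longlonglongrightarrow> 0"
        using tendsto_add[OF ennreal_tendsto_cmult[OF _ s(2), of "ennreal \<bar>a\<bar>"]
            ennreal_tendsto_cmult[OF _ t(2), of "ennreal \<bar>b\<bar>"]] by simp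
    qed simp_all
  qed
qed

text \<open>Bochner's criterion: dominated simple functions converge to \<open>f\<close> in
  \<open>L^1\<close>, so their integrals form a Cauchy sequence, and completeness of the target
  space provides the limit.\<close>

lemma (in complete_measure) has_bochner_bochner:
  fixes f :: "'a \<Rightarrow> 'b::{real_normed_vector, complete_space}"
  assumes f: "strongly_measurable M f" and fin: "(\<integral>\<^sup>+x. norm (f x) \<partial>M) < \<infinity>"
  shows "has_bochner M f (bochner M f)"
proof -
  obtain s where s: "\<And>i::nat. simple_function M (s i)" "AE x in M. (\<lambda>i. s i x) \<longlonglongrightarrow> f x"
    using f by (auto simp: strongly_measurable_def)
  have nf[measurable]: "(\<lambda>x. norm (f x)) \<in> borel_measurable M"
    using f by (rule borel_measurable_norm_strongly_measurable)
  \<comment> \<open>Truncating the simple functions at twice the norm of \<open>f\<close> makes them dominated without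
    destroying the pointwise convergence.\<close>
  define r where "r i x = (if norm (s i x) \<le> 2 * norm (f x) then s i x else 0)" for i x
  have ns[measurable]: "(\<lambda>x. norm (s i x)) \<in> borel_measurable M" for i
    using simple_function_compose1[OF s(1), of norm] by (rule borel_measurable_simple_function)
  have r: "simple_function M (r i)" for i
    unfolding r_def by (intro simple_function_If s simple_function_const) measurable
  have rf: "norm (r i x) \<le> 2 * norm (f x)" for i x
    by (simp add: r_def)
  have [measurable]: "(\<lambda>x. norm (f x - r i x)) \<in> borel_measurable M" for i
    using f r by (rule borel_measurable_norm_diff_simple_function)
  have lim: "AE x in M. (\<lambda>i. r i x) \<longlonglongrightarrow> f x"
    using s(2)
  proof eventually_elim
    case (elim x)
    show ?case
    proof (cases "f x = 0")
      case True
      then have "r i x = 0" for i using rf[of i x] by simp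
      then show ?thesis using True by simp
    next
      case False
      have "(\<lambda>i. norm (s i x)) \<longlonglongrightarrow> norm (f x)"
        using elim by (rule tendsto_norm)
      then have "\<forall>\<^sub>F i in sequentially. norm (s i x) < 2 * norm (f x)"
        by (rule order_tendstoD) (use False in simp)
      then have "\<forall>\<^sub>F i in sequentially. s i x = r i x"
        by eventually_elim (simp add: r_def)
      then show ?thesis using elim by (rule Lim_transform_eventually[rotated])
    qed
  qed
  have rint: "Bochner_Integration.simple_bochner_integrable M (r i)" for i
  proof (rule simple_bochner_integrableI_bounded[OF r])
    have "(\<integral>\<^sup>+x. norm (r i x) \<partial>M) \<le> (\<integral>\<^sup>+x. 2 * ennreal (norm (f x)) \<partial>M)"
      using rf by (intro nn_integral_mono) (metis ennreal_leI ennreal_mult' ennreal_numeral norm_ge_zero zero_le_numeral)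
    also have "\<dots> < \<infinity>"
      using fin by (subst nn_integral_cmult) (auto simp: ennreal_mult_less_top)
    finally show "(\<integral>\<^sup>+x. norm (r i x) \<partial>M) < \<infinity>" .
  qed
  have conv: "(\<lambda>i. \<integral>\<^sup>+x. ennreal (norm (f x - r i x)) \<partial>M) \<longlonglongrightarrow> 0"
  proof -
    have "(\<lambda>i. \<integral>\<^sup>+x. ennreal (norm (f x - r i x)) \<partial>M) \<longlonglongrightarrow> (\<integral>\<^sup>+x. 0 \<partial>M)"
    \<comment> \<open>The constant 3 is 1 for \<open>f\<close> plus 2 for the truncated simple
      function.\<close>
    proof (rule nn_integral_dominated_convergence[where w="\<lambda>x. ennreal (3 * norm (f x))"])
      show "AE x in M. ennreal (norm (f x - r i x)) \<le> ennreal (3 * norm (f x))" for i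
      proof (intro AE_I2 ennreal_leI)
        fix x show "norm (f x - r i x) \<le> 3 * norm (f x)"
          using norm_triangle_ineq4[of "f x" "r i x"] rf[of i x] by linarith
      qed
      show "(\<integral>\<^sup>+x. ennreal (3 * norm (f x)) \<partial>M) < \<infinity>"
        using fin by (simp add: ennreal_mult nn_integral_cmult ennreal_mult_less_top)
      show "AE x in M. (\<lambda>i. ennreal (norm (f x - r i x))) \<longlonglongrightarrow> 0"
        using lim
      proof eventually_elim
        case (elim x)
        have "(\<lambda>i. norm (f x - r i x)) \<longlonglongrightarrow> norm (f x - f x)"
          using elim by (intro tendsto_intros)
        then show ?case
          using tendsto_ennrealI[of "\<lambda>i. norm (f x - r i x)" 0] by simp
      qed
    qed auto
    then show ?thesis by simp
  qed
  let ?I = "\<lambda>i. Bochner_Integration.simple_bochner_integral M (r i)"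
  have "Cauchy ?I"
  proof (rule CauchyI)
    fix e :: real assume e: "0 < e"
    have "\<forall>\<^sub>F i in sequentially. (\<integral>\<^sup>+x. ennreal (norm (f x - r i x)) \<partial>M) < ennreal (e/2)"
      using conv by (rule order_tendstoD) (use e in simp)
    then obtain n where n: "\<And>i. i \<ge> n \<Longrightarrow> (\<integral>\<^sup>+x. ennreal (norm (f x - r i x)) \<partial>M) < ennreal (e/2)"
      by (auto simp: eventually_sequentially)
    have "norm (?I i - ?I j) < e" if "i \<ge> n" "j \<ge> n" for i j
    proof -
      have "ennreal (norm (?I i - ?I j)) \<le>
          (\<integral>\<^sup>+x. norm (f x - r i x) \<partial>M) + (\<integral>\<^sup>+x. norm (f x - r j x) \<partial>M)"
        by (intro simple_bochner_integral_dist f rint)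
      also have "\<dots> < ennreal (e/2) + ennreal (e/2)"
        using n[OF that(1)] n[OF that(2)] by (rule add_strict_mono)
      also have "\<dots> = ennreal e" using e by (simp flip: ennreal_plus)
      finally show ?thesis using e by (simp add: ennreal_less_iff)
    qed
    then show "\<exists>n. \<forall>i\<ge>n. \<forall>j\<ge>n. norm (?I i - ?I j) < e" by blast
  qed
  then obtain I where "?I \<longlonglongrightarrow> I"
    using Cauchy_convergent_iff convergent_def by blast
  then have "has_bochner M f I"
    unfolding has_bochner_def using f rint conv by blast
  then show ?thesis by (simp add: bochner_eq)
qed

section \<open>The semigroup on the extrapolation space and the input map\<close>

text \<open>Banach-Steinhaus: pointwise boundedness says that the closed sets \<open>C n\<close>
  cover the space, and by Baire's theorem one of them contains a ball.\<close>

lemma uniform_boundedness: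
  fixes F :: "'i \<Rightarrow> 'a::{real_normed_vector, complete_space} \<Rightarrow> 'b::real_normed_vector"
  assumes lin: "\<And>i. i \<in> I \<Longrightarrow> bounded_linear (F i)"
    and pt: "\<And>x. bounded ((\<lambda>i. F i x) ` I)"
  obtains M where "0 \<le> M" "\<And>i x. i \<in> I \<Longrightarrow> norm (F i x) \<le> M * norm x"
proof -
  define C where "C n = {x. \<forall>i\<in>I. norm (F i x) \<le> real n}" for n :: nat
  have closed: "closed (C n)" for n
  proof -
    have "C n = (\<Inter>i\<in>I. {x. norm (F i x) \<le> real n})"
      by (auto simp: C_def)
    also have "closed \<dots>"
      using lin by (intro closed_INT ballI closed_Collect_le continuous_on_norm continuous_on_const
          linear_continuous_on)
    finally show ?thesis .
  qed
  have cover: "\<Union>(range C) = UNIV"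
  proof (intro equalityI subsetI)
    fix x :: 'a
    obtain b where "\<forall>i\<in>I. norm (F i x) \<le> b"
      using pt[of x] by (auto simp: bounded_iff)
    moreover obtain n :: nat where "b \<le> real n" using real_arch_simple by blast
    ultimately have "x \<in> C n" by (force simp: C_def)
    then show "x \<in> \<Union>(range C)" by blast
  qed simp
  have "\<exists>n. interior (C n) \<noteq> {}"
  proof (rule ccontr)
    assume "\<not> ?thesis"
    then have "(euclidean :: 'a topology) interior_of \<Union>(range C) = {}"
      using closed completely_metrizable_space_euclidean[where ?'a='a]
      by (intro Baire_category_alt) auto
    then show False by (simp add: cover)
  qed
  then obtain n x r where r: "r > 0" "ball x r \<subseteq> C n"
    by (meson all_not_in_conv mem_interior)
  \<comment> \<open>Writing \<open>y\<close> as a difference of two points of the ball moves the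
    estimate to the origin, at the price of doubling \<open>n\<close>.\<close>
  have small: "norm (F i y) \<le> 2 * real n" if "i \<in> I" "norm y < r" for i y
  proof -
    interpret bounded_linear "F i" using lin that(1) .
    have "x \<in> C n" "x + y \<in> C n"
      using r that(2) by (auto simp: dist_norm subset_eq)
    then have "norm (F i x) \<le> n" "norm (F i (x + y)) \<le> n"
      using that(1) by (auto simp: C_def)
    moreover have "F i y = F i (x + y) - F i x" by (simp add: add)
    ultimately show ?thesis
      using norm_triangle_ineq4[of "F i (x + y)" "F i x"] by simp
  qed
  \<comment> \<open>Rescaling \<open>v\<close> to norm \<open>r / 2\<close>, strictly inside the
    open ball, turns the bound \<open>2 * n\<close> into \<open>4 * n / r\<close>.\<close>
  show thesis
  proof (rule that[of "4 * real n / r"])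
    fix i v assume i: "i \<in> I"
    interpret bounded_linear "F i" using lin i .
    show "norm (F i v) \<le> 4 * real n / r * norm v"
    proof (cases "v = 0")
      case False
      have "norm (F i ((r / (2 * norm v)) *\<^sub>R v)) \<le> 2 * real n"
        using r False by (intro small i) auto
      then have "r / (2 * norm v) * norm (F i v) \<le> 2 * real n"
        using r by (simp add: scaleR)
      then show ?thesis using r False by (simp add: field_simps)
    qed (simp add: zero)
  qed (use r in auto)
qed

text \<open>Each orbit over \<open>{0..T}\<close> is a continuous image of a compact set, which is
  the pointwise boundedness that Banach-Steinhaus asks for.\<close>

lemma C0_semigroup_bounded:
  assumes "C0_semigroup S"
  obtains M where "0 \<le> M" "\<And>t x. t \<in> {0..T} \<Longrightarrow> norm (S t x) \<le> M * norm x"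
proof (rule uniform_boundedness[of "{0..T}" S])
  show "bounded_linear (S t)" if "t \<in> {0..T}" for t
    using assms that by (auto simp: C0_semigroup_def bounded_clinear_def)
  show "bounded ((\<lambda>t. S t x) ` {0..T})" for x
    using assms by (intro compact_imp_bounded compact_continuous_image)
      (auto simp: C0_semigroup_def intro: continuous_on_subset[of "{0..}"])
qed (use that in blast)

lemma generator_eq:
  assumes "is_generator_value S x y"
  shows "generator S x = y"
  unfolding generator_def
proof (rule the_equality)
  fix z assume "is_generator_value S x z"
  then show "z = y"
    using assms unfolding is_generator_value_def
    by (rule tendsto_unique[OF trivial_limit_at_right_real])
qed (rule assms)

text \<open>\<open>S t\<close> commutes with \<open>S h\<close>, hence with the difference
  quotients, and its continuity lets it pass to their limit.\<close>

lemma is_generator_value_semigroup: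
  assumes S: "C0_semigroup S" and "0 \<le> t" and x: "is_generator_value S x y"
  shows "is_generator_value S (S t x) (S t y)"
proof -
  interpret bounded_linear "S t"
    using assms by (auto simp: C0_semigroup_def bounded_clinear_def)
  have "((\<lambda>h. S t ((1 / h) *\<^sub>R (S h x - x))) \<longlongrightarrow> S t y) (at_right 0)"
    using x unfolding is_generator_value_def by (rule tendsto)
  moreover have "\<forall>\<^sub>F h in at_right 0. S t ((1 / h) *\<^sub>R (S h x - x)) = (1 / h) *\<^sub>R (S h (S t x) - S t x)"
    using eventually_at_right_less[of 0]
  proof eventually_elim
    case (elim h)
    have "S h (S t x) = S t (S h x)"
      using S elim \<open>0 \<le> t\<close> unfolding C0_semigroup_def by (metis add.commute less_imp_le)
    then show ?case by (simp add: scaleR diff)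
  qed
  ultimately show ?thesis
    unfolding is_generator_value_def by (rule Lim_transform_eventually)
qed

text \<open>Since \<open>S t\<close> commutes with the generator, \<beta> minus the generator sends
  \<open>S t (resolvent S \<beta> w)\<close> to \<open>S t w\<close>; injectivity on the domain
  identifies the preimage.\<close>

lemma resolvent_semigroup:
  assumes S: "C0_semigroup S" and "0 \<le> t" and \<beta>: "\<beta> \<in> resolvent_set S"
  shows "resolvent S \<beta> (S t w) = S t (resolvent S \<beta> w)"
proof -
  let ?f = "\<lambda>x. \<beta> *\<^sub>C x - generator S x"
  have bij: "bij_betw ?f (generator_domain S) UNIV"
    using \<beta> by (simp add: resolvent_set_def)
  define x where "x = resolvent S \<beta> w"
  have fx: "?f x = w" and "x \<in> generator_domain S"
    using f_the_inv_into_f_bij_betw[OF bij, of w] the_inv_into_into[of ?f "generator_domain S" w] bij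
    by (auto simp: x_def resolvent_def bij_betw_def)
  then obtain y where y: "is_generator_value S x y" by (auto simp: generator_domain_def)
  have Sy: "is_generator_value S (S t x) (S t y)"
    using S \<open>0 \<le> t\<close> y by (rule is_generator_value_semigroup)
  have lin: "bounded_linear (S t)" "\<And>c v. S t (c *\<^sub>C v) = c *\<^sub>C S t v"
    using S \<open>0 \<le> t\<close> by (auto simp: C0_semigroup_def bounded_clinear_def)
  have "?f (S t x) = S t w"
    using fx generator_eq[OF y] generator_eq[OF Sy] lin(2) bounded_linear.linear[OF lin(1)]
    by (auto simp: linear_diff)
  then show ?thesis
    unfolding resolvent_def x_def[unfolded resolvent_def, symmetric]
    using bij Sy by (intro the_inv_into_f_eq) (auto simp: bij_betw_def generator_domain_def)
qed

section \<open>Extension of the semigroup to the extrapolation space\<close>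

locale extrapolated_semigroup =
  fixes S :: "real \<Rightarrow> 'h::complex_hilbert \<Rightarrow> 'h" and \<beta> :: complex
    and \<iota> :: "'h \<Rightarrow> 'e::complex_banach"
  assumes semigroup: "C0_semigroup S" and extrapolation: "extrapolation_space S \<beta> \<iota>"
begin

lemma semigroup_bounded_linear: "0 \<le> t \<Longrightarrow> bounded_linear (S t)"
  using semigroup by (auto simp: C0_semigroup_def bounded_clinear_def)

lemma embedding_bounded_linear: "bounded_linear \<iota>"
proof -
  have "bounded_linear (resolvent S \<beta>)"
    using extrapolation
    by (auto simp: extrapolation_space_def resolvent_set_def bounded_clinear_def)
  then obtain K where K: "\<And>x. norm (resolvent S \<beta> x) \<le> norm x * K"
    by (auto dest: bounded_linear.bounded)
  show ?thesis
  proof (rule bounded_linear_intro[where K=K])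
    show "\<iota> (r *\<^sub>R x) = r *\<^sub>R \<iota> x" for r x
      using extrapolation unfolding extrapolation_space_def by (metis scaleC_of_real)
  qed (use extrapolation K in \<open>auto simp: extrapolation_space_def\<close>)
qed

text \<open>The norm of \<open>\<iota> x\<close> is that of the resolvent of \<open>x\<close>, and
  \<open>S t\<close> can be moved out of the resolvent. So the operator bound on the original space
  holds verbatim in the weaker norm.\<close>

lemma norm_embedding_semigroup:
  assumes M: "\<And>x. norm (S t x) \<le> M * norm x" and "0 \<le> t"
  shows "norm (\<iota> (S t x)) \<le> M * norm (\<iota> x)"
proof -
  have "norm (\<iota> (S t x)) = norm (S t (resolvent S \<beta> x))"
    using extrapolation resolvent_semigroup[OF semigroup \<open>0 \<le> t\<close>, of \<beta> x]
    by (auto simp: extrapolation_space_def)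
  also have "\<dots> \<le> M * norm (resolvent S \<beta> x)" by (rule M)
  also have "\<dots> = M * norm (\<iota> x)" using extrapolation by (auto simp: extrapolation_space_def)
  finally show ?thesis .
qed

lemma embedding_dense: obtains x where "(\<lambda>n. \<iota> (x n)) \<longlonglongrightarrow> e"
proof -
  have "e \<in> closure (range \<iota>)" using extrapolation by (simp add: extrapolation_space_def)
  then obtain f where "\<forall>n. f n \<in> range \<iota>" "f \<longlonglongrightarrow> e" by (auto simp: closure_sequential)
  then have "(\<lambda>n. \<iota> (inv_into UNIV \<iota> (f n))) \<longlonglongrightarrow> e" by (simp add: f_inv_into_f)
  then show thesis by (rule that)
qed

text \<open>On the dense range of \<open>\<iota>\<close> the map is forced and Lipschitz, so it
  extends uniquely by uniform continuity; additivity, homogeneity and the bound pass to limits of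
  sequences from the range.\<close>

lemma extended_semigroup_exists:
  assumes M: "\<And>x. norm (S t x) \<le> M * norm x" and t: "0 \<le> t"
  obtains E where "bounded_linear E" "\<And>x. E (\<iota> x) = \<iota> (S t x)" "\<And>e. norm (E e) \<le> M * norm e"
proof -
  interpret St: bounded_linear "S t" using t by (rule semigroup_bounded_linear)
  interpret \<iota>: bounded_linear \<iota> by (rule embedding_bounded_linear)
  define g where "g e = \<iota> (S t (inv_into UNIV \<iota> e))" for e
  \<comment> \<open>The preimage chosen in \<open>g\<close> may differ from \<open>x\<close>, but
    the difference has image zero under \<open>\<iota>\<close>, and by the norm estimate it still
    has after applying \<open>S t\<close>.\<close>
  have g: "g (\<iota> x) = \<iota> (S t x)" for x
  proof -
    have "\<iota> (inv_into UNIV \<iota> (\<iota> x)) = \<iota> x" by (simp add: f_inv_into_f)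
    then have "norm (\<iota> (S t (inv_into UNIV \<iota> (\<iota> x) - x))) \<le> 0"
      using norm_embedding_semigroup[OF M t, of "inv_into UNIV \<iota> (\<iota> x) - x"] by (simp add: \<iota>.diff)
    then show ?thesis by (simp add: g_def \<iota>.diff St.diff)
  qed
  \<comment> \<open>A Lipschitz constant has to be nonnegative, which is not assumed of
    \<open>M\<close>.\<close>
  have bd: "norm (\<iota> (S t x)) \<le> \<bar>M\<bar> * norm (\<iota> x)" for x
    using norm_embedding_semigroup[OF M t, of x]
    by (meson abs_ge_self mult_right_mono norm_ge_zero order_trans)
  have "uniformly_continuous_on (range \<iota>) g"
  proof (rule lipschitz_on_uniformly_continuous)
    show "\<bar>M\<bar>-lipschitz_on (range \<iota>) g"
    proof (rule lipschitz_onI)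
      fix a b assume "a \<in> range \<iota>" "b \<in> range \<iota>"
      then obtain x y where "a = \<iota> x" "b = \<iota> y" by blast
      then show "dist (g a) (g b) \<le> \<bar>M\<bar> * dist a b"
        using bd[of "x - y"] by (simp add: g dist_norm \<iota>.diff St.diff)
    qed simp
  qed
  then obtain E where E: "uniformly_continuous_on UNIV E" "\<And>x. E (\<iota> x) = \<iota> (S t x)"
    using uniformly_continuous_on_extension_on_closure[of "range \<iota>" g] extrapolation g
    unfolding extrapolation_space_def by (metis rangeI)
  have lim: "(\<lambda>n. \<iota> (S t (x n))) \<longlonglongrightarrow> E e" if "(\<lambda>n. \<iota> (x n)) \<longlonglongrightarrow> e" for x e
  proof -
    have "isCont E e"
      using E(1) by (metis UNIV_I continuous_on_eq_continuous_at open_UNIV uniformly_continuous_imp_continuous)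
    from isCont_tendsto_compose[OF this that] show ?thesis by (simp add: E(2))
  qed
  have add: "E (a + b) = E a + E b" for a b
  proof -
    obtain x y where x: "(\<lambda>n. \<iota> (x n)) \<longlonglongrightarrow> a" and y: "(\<lambda>n. \<iota> (y n)) \<longlonglongrightarrow> b"
      using embedding_dense by metis
    have "(\<lambda>n. \<iota> (S t (x n + y n))) \<longlonglongrightarrow> E (a + b)"
      using tendsto_add[OF x y] by (intro lim) (simp add: \<iota>.add)
    moreover have "(\<lambda>n. \<iota> (S t (x n + y n))) \<longlonglongrightarrow> E a + E b"
      using tendsto_add[OF lim[OF x] lim[OF y]] by (simp add: \<iota>.add St.add)
    ultimately show ?thesis by (rule LIMSEQ_unique)
  qed
  have scale: "E (r *\<^sub>R a) = r *\<^sub>R E a" for r a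
  proof -
    obtain x where x: "(\<lambda>n. \<iota> (x n)) \<longlonglongrightarrow> a"
      using embedding_dense by metis
    have "(\<lambda>n. \<iota> (S t (r *\<^sub>R x n))) \<longlonglongrightarrow> E (r *\<^sub>R a)"
      using tendsto_scaleR[OF tendsto_const x] by (intro lim) (simp add: \<iota>.scaleR)
    moreover have "(\<lambda>n. \<iota> (S t (r *\<^sub>R x n))) \<longlonglongrightarrow> r *\<^sub>R E a"
      using tendsto_scaleR[OF tendsto_const lim[OF x]] by (simp add: \<iota>.scaleR St.scaleR)
    ultimately show ?thesis by (rule LIMSEQ_unique)
  qed
  have norm: "norm (E a) \<le> M * norm a" for a
  proof -
    obtain x where x: "(\<lambda>n. \<iota> (x n)) \<longlonglongrightarrow> a"
      using embedding_dense by metis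
    show ?thesis
    proof (rule LIMSEQ_le[OF tendsto_norm[OF lim[OF x]] tendsto_mult[OF tendsto_const tendsto_norm[OF x]]])
      show "\<exists>N. \<forall>n\<ge>N. norm (\<iota> (S t (x n))) \<le> M * norm (\<iota> (x n))"
        using norm_embedding_semigroup[OF M t] by blast
    qed
  qed
  show thesis
    using add scale norm E(2)
    by (intro that[of E] bounded_linear_intro[where K=M]) (auto simp: mult.commute)
qed

text \<open>Resolves the \<open>THE\<close> in \<open>extended_semigroup\<close>: bounded linear
  maps that agree on the dense range of \<open>\<iota>\<close> are equal.\<close>

lemma extended_semigroup:
  assumes M: "\<And>x. norm (S t x) \<le> M * norm x" and t: "0 \<le> t"
  shows "bounded_linear (extended_semigroup S \<iota> t)"
    and "extended_semigroup S \<iota> t (\<iota> x) = \<iota> (S t x)"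
    and "norm (extended_semigroup S \<iota> t e) \<le> M * norm e"
proof -
  obtain E where E: "bounded_linear E" "\<And>x. E (\<iota> x) = \<iota> (S t x)" "\<And>e. norm (E e) \<le> M * norm e"
    using extended_semigroup_exists[OF M t] by blast
  have "extended_semigroup S \<iota> t = E"
    unfolding extended_semigroup_def
  proof (rule the_equality)
    fix E' assume E': "bounded_linear E' \<and> (\<forall>x. E' (\<iota> x) = \<iota> (S t x))"
    show "E' = E"
    proof
      fix e
      obtain x where x: "(\<lambda>n. \<iota> (x n)) \<longlonglongrightarrow> e" using embedding_dense by metis
      have "(\<lambda>n. \<iota> (S t (x n))) \<longlonglongrightarrow> E e" "(\<lambda>n. \<iota> (S t (x n))) \<longlonglongrightarrow> E' e"
        using bounded_linear.tendsto[OF _ x, of E] bounded_linear.tendsto[OF _ x, of E'] E E' by auto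
      then show "E' e = E e" using LIMSEQ_unique by blast
    qed
  qed (use E in auto)
  then show "bounded_linear (extended_semigroup S \<iota> t)"
    "extended_semigroup S \<iota> t (\<iota> x) = \<iota> (S t x)"
    "norm (extended_semigroup S \<iota> t e) \<le> M * norm e" using E by auto
qed

text \<open>For \<open>e\<close> in the range of \<open>\<iota>\<close> this is strong continuity of
  \<open>S\<close>. For general \<open>e\<close>, approximation from the range is uniform in
  \<open>t\<close> because one \<open>M\<close> serves all of \<open>{0..T}\<close>.\<close>

lemma continuous_on_extended_semigroup:
  assumes M: "\<And>t x. t \<in> {0..T} \<Longrightarrow> norm (S t x) \<le> M * norm x"
  shows "continuous_on {0..T} (\<lambda>t. extended_semigroup S \<iota> t e)"
proof -
  obtain x where x: "(\<lambda>n. \<iota> (x n)) \<longlonglongrightarrow> e" using embedding_dense by metis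
  show ?thesis
  proof (rule uniform_limit_theorem)
    show "\<forall>\<^sub>F n in sequentially. continuous_on {0..T} (\<lambda>t. \<iota> (S t (x n)))"
    proof (intro always_eventually allI)
      fix n
      have "continuous_on {0..T} (\<lambda>t. S t (x n))"
        using semigroup by (auto simp: C0_semigroup_def intro: continuous_on_subset[of "{0..}"])
      then show "continuous_on {0..T} (\<lambda>t. \<iota> (S t (x n)))"
        by (rule bounded_linear.continuous_on[OF embedding_bounded_linear])
    qed
    show "uniform_limit {0..T} (\<lambda>n t. \<iota> (S t (x n))) (\<lambda>t. extended_semigroup S \<iota> t e) sequentially"
    proof (rule uniform_limitI)
      fix d :: real assume d: "0 < d"
      have "(\<lambda>n. \<bar>M\<bar> * norm (\<iota> (x n) - e)) \<longlonglongrightarrow> \<bar>M\<bar> * norm (e - e)"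
        using x by (intro tendsto_intros)
      then have "\<forall>\<^sub>F n in sequentially. \<bar>M\<bar> * norm (\<iota> (x n) - e) < d"
        using d by (intro order_tendstoD) auto
      then show "\<forall>\<^sub>F n in sequentially. \<forall>t\<in>{0..T}. dist (\<iota> (S t (x n))) (extended_semigroup S \<iota> t e) < d"
      proof (eventually_elim, intro ballI)
        fix n t assume n: "\<bar>M\<bar> * norm (\<iota> (x n) - e) < d" and t: "t \<in> {0..T}"
        note E = extended_semigroup[OF M[OF t]]
        have "dist (\<iota> (S t (x n))) (extended_semigroup S \<iota> t e) =
            norm (extended_semigroup S \<iota> t (\<iota> (x n) - e))"
          using t E(2) linear_diff[OF bounded_linear.linear[OF E(1)]] by (simp add: dist_norm)
        also have "\<dots> \<le> M * norm (\<iota> (x n) - e)" using t by (intro E(3)) simp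
        also have "\<dots> \<le> \<bar>M\<bar> * norm (\<iota> (x n) - e)" by (intro mult_right_mono) auto
        finally show "dist (\<iota> (S t (x n))) (extended_semigroup S \<iota> t e) < d" using n by simp
      qed
    qed
  qed simp
qed

end

section \<open>Measurability of the evolution integrand and linearity of the input map\<close>

lemma strongly_measurable_evolution:
  fixes E :: "real \<Rightarrow> 'a::real_normed_vector \<Rightarrow> 'b::real_normed_vector"
  assumes f: "strongly_measurable (lebesgue_on {0<..<t}) f"
    and lin: "\<And>s. s \<in> {0..t} \<Longrightarrow> bounded_linear (E s)"
    and M: "\<And>s e. s \<in> {0..t} \<Longrightarrow> norm (E s e) \<le> M * norm e"
    and cont: "\<And>e. continuous_on {0..t} (\<lambda>s. E s e)"
  shows "strongly_measurable (lebesgue_on {0<..<t}) (\<lambda>\<sigma>. E (t - \<sigma>) (f \<sigma>))"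
proof -
  obtain s where s: "\<And>i::nat. simple_function (lebesgue_on {0<..<t}) (s i)"
      "AE x in lebesgue_on {0<..<t}. (\<lambda>i. s i x) \<longlonglongrightarrow> f x"
    using f by (auto simp: strongly_measurable_def)
  \<comment> \<open>Rounding the time argument down to multiples of \<open>1 / (n + 1)\<close> yields simple functions at once;
    arguing by limits of strongly measurable functions would need Egorov's theorem.\<close>
  define q where "q n \<sigma> = real_of_int \<lfloor>real (Suc n) * \<sigma>\<rfloor> / real (Suc n)" for n :: nat and \<sigma> :: real
  have q_le: "q n \<sigma> \<le> \<sigma>" and q_ge: "\<sigma> - inverse (real (Suc n)) \<le> q n \<sigma>" for n \<sigma>
  proof -
    have "real_of_int \<lfloor>real (Suc n) * \<sigma>\<rfloor> \<le> real (Suc n) * \<sigma>" by (rule of_int_floor_le)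
    then show "q n \<sigma> \<le> \<sigma>" unfolding q_def by (simp add: divide_le_eq mult.commute)
    have "real (Suc n) * \<sigma> - 1 \<le> real_of_int \<lfloor>real (Suc n) * \<sigma>\<rfloor>" by linarith
    then have "(real (Suc n) * \<sigma> - 1) / real (Suc n) \<le> q n \<sigma>"
      unfolding q_def by (intro divide_right_mono) auto
    then show "\<sigma> - inverse (real (Suc n)) \<le> q n \<sigma>"
      by (simp add: diff_divide_distrib inverse_eq_divide)
  qed
  \<comment> \<open>Rounding down keeps \<open>q n \<sigma>\<close> between 0 and
    \<open>\<sigma>\<close>, so \<open>t - q n \<sigma>\<close> never leaves \<open>{0..t}\<close>,
    where the assumptions on \<open>E\<close> apply.\<close>
  have q_nonneg: "0 \<le> q n \<sigma>" if "0 < \<sigma>" for n \<sigma>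
    using that by (simp add: q_def)
  have q_lim: "(\<lambda>n. q n \<sigma>) \<longlonglongrightarrow> \<sigma>" for \<sigma>
  proof (rule tendsto_sandwich)
    show "(\<lambda>n. \<sigma> - inverse (real (Suc n))) \<longlonglongrightarrow> \<sigma>"
      using tendsto_diff[OF tendsto_const[of \<sigma>] LIMSEQ_inverse_real_of_nat] by simp
  qed (use q_le q_ge in auto)
  have q_simple: "simple_function (lebesgue_on {0<..<t}) (q n)" for n
  proof (rule simple_function_borel_measurable)
    have "q n \<in> borel_measurable borel" unfolding q_def by measurable
    then show "q n \<in> borel_measurable (lebesgue_on {0<..<t})"
      by (intro measurable_restrict_space1 measurable_completion) simp
    have "q n ` {0<..<t} \<subseteq> (\<lambda>k. real_of_int k / real (Suc n)) ` {0..\<lfloor>real (Suc n) * t\<rfloor>}"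
    proof (rule image_subsetI)
      fix \<sigma> assume "\<sigma> \<in> {0<..<t}"
      then show "q n \<sigma> \<in> (\<lambda>k. real_of_int k / real (Suc n)) ` {0..\<lfloor>real (Suc n) * t\<rfloor>}"
        unfolding q_def by (intro imageI) (auto intro!: floor_mono mult_left_mono simp del: of_nat_Suc)
    qed
    then show "finite (q n ` space (lebesgue_on {0<..<t}))"
      by (simp add: finite_subset)
  qed
  show ?thesis
    unfolding strongly_measurable_def
  proof (intro exI conjI allI)
    show "simple_function (lebesgue_on {0<..<t}) (\<lambda>\<sigma>. E (t - q i \<sigma>) (s i \<sigma>))" for i
      using q_simple[of i] s(1)[of i] by (rule simple_function_compose2)
    show "AE \<sigma> in lebesgue_on {0<..<t}. (\<lambda>i. E (t - q i \<sigma>) (s i \<sigma>)) \<longlonglongrightarrow> E (t - \<sigma>) (f \<sigma>)"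
      using s(2) AE_space
    proof eventually_elim
      case (elim \<sigma>)
      then have \<sigma>: "0 < \<sigma>" "\<sigma> < t" by auto
      have mem: "t - q n \<sigma> \<in> {0..t}" for n
        using q_le[of n \<sigma>] q_nonneg[OF \<sigma>(1), of n] \<sigma> by auto
      \<comment> \<open>Time and vector vary together, so the error is split: the time error at the
        fixed vector \<open>f \<sigma>\<close> vanishes by strong continuity, the vector error by
        the bound \<open>M\<close> uniform in time.\<close>
      have "(\<lambda>i. E (t - q i \<sigma>) (f \<sigma>)) \<longlonglongrightarrow> E (t - \<sigma>) (f \<sigma>)"
        using mem \<sigma>
        by (intro continuous_on_tendsto_compose[OF cont] tendsto_diff tendsto_const q_lim) auto
      moreover have "(\<lambda>i. E (t - q i \<sigma>) (s i \<sigma> - f \<sigma>)) \<longlonglongrightarrow> 0"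
      proof (rule Lim_null_comparison)
        show "\<forall>\<^sub>F i in sequentially. norm (E (t - q i \<sigma>) (s i \<sigma> - f \<sigma>)) \<le> M * norm (s i \<sigma> - f \<sigma>)"
          using M mem by simp
        have "(\<lambda>i. M * norm (s i \<sigma> - f \<sigma>)) \<longlonglongrightarrow> M * norm (f \<sigma> - f \<sigma>)"
          using elim(1) by (intro tendsto_intros)
        then show "(\<lambda>i. M * norm (s i \<sigma> - f \<sigma>)) \<longlonglongrightarrow> 0" by simp
      qed
      ultimately have "(\<lambda>i. E (t - q i \<sigma>) (f \<sigma>) + E (t - q i \<sigma>) (s i \<sigma> - f \<sigma>)) \<longlonglongrightarrow> E (t - \<sigma>) (f \<sigma>) + 0"
        by (rule tendsto_add)
      then show ?case
        using linear_diff[OF bounded_linear.linear[OF lin[OF mem]]] by simp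
    qed
  qed
qed

lemma strongly_measurable_bounded_linear:
  assumes f: "strongly_measurable M f" and B: "bounded_linear B"
  shows "strongly_measurable M (\<lambda>x. B (f x))"
proof -
  obtain s where s: "\<And>i::nat. simple_function M (s i)" "AE x in M. (\<lambda>i. s i x) \<longlonglongrightarrow> f x"
    using f by (auto simp: strongly_measurable_def)
  have "AE x in M. (\<lambda>i. B (s i x)) \<longlonglongrightarrow> B (f x)"
    using s(2) by eventually_elim (rule bounded_linear.tendsto[OF B])
  then show ?thesis
    unfolding strongly_measurable_def
    using simple_function_compose1[OF s(1), of B] by (intro exI[of _ "\<lambda>i x. B (s i x)"]) simp
qed

lemma integrable_lebesgue_on_subset:
  fixes f :: "real \<Rightarrow> real"
  assumes "integrable (lebesgue_on S) f" "R \<subseteq> S" "R \<in> sets lebesgue" "S \<in> sets lebesgue"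
  shows "integrable (lebesgue_on R) f"
  using assms set_integrable_subset[of lebesgue S f R]
  by (simp add: integrable_restrict_space set_integrable_def)

lemma L2_combine:
  fixes u v :: "real \<Rightarrow> 'u::real_normed_vector"
  assumes u: "u \<in> L2 S" and v: "v \<in> L2 S" and S: "S \<in> sets lebesgue"
  shows "(\<lambda>t. a *\<^sub>R u t + b *\<^sub>R v t) \<in> L2 S"
proof -
  interpret complete_measure "lebesgue_on S" using S by (rule complete_measure_lebesgue_on)
  have sm: "strongly_measurable (lebesgue_on S) (\<lambda>t. a *\<^sub>R u t + b *\<^sub>R v t)"
    using u v by (auto simp: L2_def intro: strongly_measurable_combine)
  have "integrable (lebesgue_on S) (\<lambda>t. (norm (a *\<^sub>R u t + b *\<^sub>R v t))\<^sup>2)"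
  proof (rule Bochner_Integration.integrable_bound)
    show "integrable (lebesgue_on S) (\<lambda>t. 2 * a\<^sup>2 * (norm (u t))\<^sup>2 + 2 * b\<^sup>2 * (norm (v t))\<^sup>2)"
      using u v by (auto simp: L2_def)
    have [measurable]: "(\<lambda>t. norm (a *\<^sub>R u t + b *\<^sub>R v t)) \<in> borel_measurable (lebesgue_on S)"
      using sm by (rule borel_measurable_norm_strongly_measurable)
    show "(\<lambda>t. (norm (a *\<^sub>R u t + b *\<^sub>R v t))\<^sup>2) \<in> borel_measurable (lebesgue_on S)"
      by measurable
    show "AE t in lebesgue_on S. norm ((norm (a *\<^sub>R u t + b *\<^sub>R v t))\<^sup>2) \<le>
        norm (2 * a\<^sup>2 * (norm (u t))\<^sup>2 + 2 * b\<^sup>2 * (norm (v t))\<^sup>2)"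
    proof (rule AE_I2)
      fix t
      have "(norm (a *\<^sub>R u t + b *\<^sub>R v t))\<^sup>2 \<le> (\<bar>a\<bar> * norm (u t) + \<bar>b\<bar> * norm (v t))\<^sup>2"
        using norm_triangle_ineq[of "a *\<^sub>R u t" "b *\<^sub>R v t"] by (intro power_mono) auto
      also have "\<dots> \<le> 2 * (\<bar>a\<bar> * norm (u t))\<^sup>2 + 2 * (\<bar>b\<bar> * norm (v t))\<^sup>2"
        using sum_squares_bound[of "\<bar>a\<bar> * norm (u t)" "\<bar>b\<bar> * norm (v t)"]
        by (simp add: power2_sum)
      also have "\<dots> = 2 * a\<^sup>2 * (norm (u t))\<^sup>2 + 2 * b\<^sup>2 * (norm (v t))\<^sup>2"
        by (simp add: power_mult_distrib)
      finally show "norm ((norm (a *\<^sub>R u t + b *\<^sub>R v t))\<^sup>2) \<le>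
          norm (2 * a\<^sup>2 * (norm (u t))\<^sup>2 + 2 * b\<^sup>2 * (norm (v t))\<^sup>2)" by simp
    qed
  qed
  then show ?thesis using sm by (simp add: L2_def)
qed

context extrapolated_semigroup
begin

text \<open>Guarantees that \<open>input_map\<close> is a genuine integral for every
  \<open>u\<close> in \<open>L2\<close>, never the default value 0 of
  \<open>bochner\<close>.\<close>

lemma has_bochner_input_map:
  fixes B :: "'u::complex_hilbert \<Rightarrow> 'e"
  assumes B: "bounded_linear B" and u: "u \<in> L2 {0<..<T}" and t: "t \<in> {0..T}"
  shows "has_bochner (lebesgue_on {0<..<t}) (\<lambda>\<sigma>. extended_semigroup S \<iota> (t - \<sigma>) (B (u \<sigma>)))
    (input_map S \<iota> B t u)"
proof -
  interpret complete_measure "lebesgue_on {0<..<t}" by (rule complete_measure_lebesgue_on) simp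
  obtain M where M: "0 \<le> M" "\<And>s x. s \<in> {0..t} \<Longrightarrow> norm (S s x) \<le> M * norm x"
    using C0_semigroup_bounded[OF semigroup] by metis
  obtain K where K: "0 < K" "\<And>x. norm (B x) \<le> norm x * K"
    using bounded_linear.pos_bounded[OF B] by blast
  have E: "bounded_linear (extended_semigroup S \<iota> s)"
      "norm (extended_semigroup S \<iota> s e) \<le> M * norm e" if "s \<in> {0..t}" for s e
    using extended_semigroup[OF M(2)[OF that]] that by auto
  have sub: "strongly_measurable (lebesgue_on {0<..<t}) u"
      "integrable (lebesgue_on {0<..<t}) (\<lambda>\<sigma>. (norm (u \<sigma>))\<^sup>2)"
    using u t strongly_measurable_mono[of "{0<..<T}" u "{0<..<t}"]
      integrable_lebesgue_on_subset[of "{0<..<T}" "\<lambda>\<sigma>. (norm (u \<sigma>))\<^sup>2" "{0<..<t}"]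
    by (auto simp: L2_def greaterThanLessThan_subseteq_greaterThanLessThan)
  have sm: "strongly_measurable (lebesgue_on {0<..<t})
      (\<lambda>\<sigma>. extended_semigroup S \<iota> (t - \<sigma>) (B (u \<sigma>)))"
    by (rule strongly_measurable_evolution[OF strongly_measurable_bounded_linear[OF sub(1) B]
          E continuous_on_extended_semigroup[OF M(2)]])
  moreover have "(\<integral>\<^sup>+\<sigma>. norm (extended_semigroup S \<iota> (t - \<sigma>) (B (u \<sigma>))) \<partial>lebesgue_on {0<..<t}) < \<infinity>"
  proof -
    have "(\<integral>\<^sup>+\<sigma>. norm (extended_semigroup S \<iota> (t - \<sigma>) (B (u \<sigma>))) \<partial>lebesgue_on {0<..<t}) \<le>
        (\<integral>\<^sup>+\<sigma>. norm (M * K * (1 + (norm (u \<sigma>))\<^sup>2)) \<partial>lebesgue_on {0<..<t})"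
    proof (intro nn_integral_mono ennreal_leI)
      fix \<sigma> assume "\<sigma> \<in> space (lebesgue_on {0<..<t})"
      then have "t - \<sigma> \<in> {0..t}" by auto
      then have "norm (extended_semigroup S \<iota> (t - \<sigma>) (B (u \<sigma>))) \<le> M * norm (B (u \<sigma>))" by (rule E)
      also have "\<dots> \<le> M * (norm (u \<sigma>) * K)" using M(1) K(2) by (rule mult_left_mono[rotated])
      \<comment> \<open>Square integrability is turned into integrability by dominating the norm by
        1 plus its square; the constant 1 is integrable because the interval has finite
        measure.\<close>
      also have "\<dots> \<le> M * ((1 + (norm (u \<sigma>))\<^sup>2) * K)"
      proof -
        have "2 * norm (u \<sigma>) \<le> 1 + (norm (u \<sigma>))\<^sup>2"
          using sum_squares_bound[of 1 "norm (u \<sigma>)"] by simp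
        then have "norm (u \<sigma>) \<le> 1 + (norm (u \<sigma>))\<^sup>2" using norm_ge_zero[of "u \<sigma>"] by linarith
        then show ?thesis using M(1) K(1) by (intro mult_left_mono mult_right_mono) auto
      qed
      finally show "norm (extended_semigroup S \<iota> (t - \<sigma>) (B (u \<sigma>))) \<le> norm (M * K * (1 + (norm (u \<sigma>))\<^sup>2))"
        using M(1) K(1) by (simp add: ac_simps abs_mult)
    qed
    also have "\<dots> < \<infinity>"
    proof -
      interpret fm: finite_measure "lebesgue_on {0<..<t}"
        by (rule finite_measure_lebesgue_on) simp
      have "integrable (lebesgue_on {0<..<t}) (\<lambda>\<sigma>. M * K * (1 + (norm (u \<sigma>))\<^sup>2))"
        using sub(2) by (intro integrable_mult_right Bochner_Integration.integrable_add) auto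
      then show ?thesis unfolding integrable_iff_bounded by blast
    qed
    finally show ?thesis .
  qed
  ultimately show ?thesis unfolding input_map_def by (rule has_bochner_bochner)
qed

lemma input_map_combine:
  fixes B :: "'u::complex_hilbert \<Rightarrow> 'e"
  assumes B: "bounded_linear B" and u: "u \<in> L2 {0<..<T}" and v: "v \<in> L2 {0<..<T}" and t: "t \<in> {0..T}"
  shows "input_map S \<iota> B t (\<lambda>s. a *\<^sub>R u s + b *\<^sub>R v s) = a *\<^sub>R input_map S \<iota> B t u + b *\<^sub>R input_map S \<iota> B t v"
proof -
  interpret complete_measure "lebesgue_on {0<..<t}" by (rule complete_measure_lebesgue_on) simp
  obtain M where M: "0 \<le> M" "\<And>s x. s \<in> {0..t} \<Longrightarrow> norm (S s x) \<le> M * norm x"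
    using C0_semigroup_bounded[OF semigroup] by metis
  let ?E = "extended_semigroup S \<iota>"
  have eq: "?E (t - \<sigma>) (B (a *\<^sub>R u \<sigma> + b *\<^sub>R v \<sigma>)) = a *\<^sub>R ?E (t - \<sigma>) (B (u \<sigma>)) + b *\<^sub>R ?E (t - \<sigma>) (B (v \<sigma>))"
    if "\<sigma> \<in> {0<..<t}" for \<sigma>
  proof -
    interpret E: bounded_linear "?E (t - \<sigma>)"
      using that by (intro extended_semigroup(1)[of _ M] M) auto
    interpret B: bounded_linear B by fact
    show ?thesis by (simp add: E.add B.add E.scaleR B.scaleR)
  qed
  have "has_bochner (lebesgue_on {0<..<t}) (\<lambda>\<sigma>. a *\<^sub>R ?E (t - \<sigma>) (B (u \<sigma>)) + b *\<^sub>R ?E (t - \<sigma>) (B (v \<sigma>)))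
      (a *\<^sub>R input_map S \<iota> B t u + b *\<^sub>R input_map S \<iota> B t v)"
    using has_bochner_input_map[OF B u t] has_bochner_input_map[OF B v t] by (rule has_bochner_combine)
  moreover have "has_bochner (lebesgue_on {0<..<t}) (\<lambda>\<sigma>. ?E (t - \<sigma>) (B (a *\<^sub>R u \<sigma> + b *\<^sub>R v \<sigma>)))
      (input_map S \<iota> B t (\<lambda>s. a *\<^sub>R u s + b *\<^sub>R v s))"
    using B L2_combine[OF u v] t by (intro has_bochner_input_map) auto
  \<comment> \<open>Linearity of the integrand is known only for \<open>\<sigma>\<close> inside the
    interval, where \<open>t - \<sigma>\<close> is a legitimate time; that is the whole space of
    this measure.\<close>
  then have "has_bochner (lebesgue_on {0<..<t}) (\<lambda>\<sigma>. a *\<^sub>R ?E (t - \<sigma>) (B (u \<sigma>)) + b *\<^sub>R ?E (t - \<sigma>) (B (v \<sigma>)))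
      (input_map S \<iota> B t (\<lambda>s. a *\<^sub>R u s + b *\<^sub>R v s))"
    using eq by (simp add: has_bochner_def strongly_measurable_def cong: nn_integral_cong_simp AE_cong_simp)
  ultimately show ?thesis by (rule has_bochner_unique[rotated])
qed

text \<open>The dynamics are affine in \<open>(x, u)\<close>: the input map is linear, and the
  weights sum to 1, so the free evolution of \<open>x0\<close> and the terminal value
  \<open>xT\<close> are reproduced.\<close>

lemma admissible_pairs_convex:
  fixes B :: "'u::complex_hilbert \<Rightarrow> 'e"
  assumes B: "bounded_linear B" and U: "convex_functions U"
    and z: "(x, u) \<in> admissible_pairs S \<iota> B T x0 xT U" and y: "(y, v) \<in> admissible_pairs S \<iota> B T x0 xT U"
    and a: "0 \<le> a" "a \<le> 1"
  shows "(\<lambda>t. (1 - a) *\<^sub>R x t + a *\<^sub>R y t, \<lambda>t. (1 - a) *\<^sub>R u t + a *\<^sub>R v t) \<in> admissible_pairs S \<iota> B T x0 xT U"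
proof -
  note z' = z[unfolded admissible_pairs_def, simplified] and y' = y[unfolded admissible_pairs_def, simplified]
  interpret \<iota>: bounded_linear \<iota> by (rule embedding_bounded_linear)
  have split: "w = (1 - a) *\<^sub>R w + a *\<^sub>R w" for w :: "'c::real_vector"
    by (simp flip: scaleR_left_distrib)
  have "\<iota> ((1 - a) *\<^sub>R x t + a *\<^sub>R y t) =
      \<iota> (S t x0) + input_map S \<iota> B t (\<lambda>s. (1 - a) *\<^sub>R u s + a *\<^sub>R v s)" if "t \<in> {0..T}" for t
  proof -
    have "\<iota> ((1 - a) *\<^sub>R x t + a *\<^sub>R y t) =
        (1 - a) *\<^sub>R (\<iota> (S t x0) + input_map S \<iota> B t u) + a *\<^sub>R (\<iota> (S t x0) + input_map S \<iota> B t v)"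
      using z' y' that by (simp add: \<iota>.add \<iota>.scaleR)
    also have "\<dots> = ((1 - a) *\<^sub>R \<iota> (S t x0) + a *\<^sub>R \<iota> (S t x0)) +
        ((1 - a) *\<^sub>R input_map S \<iota> B t u + a *\<^sub>R input_map S \<iota> B t v)"
      by (simp add: algebra_simps)
    also have "\<dots> = \<iota> (S t x0) + input_map S \<iota> B t (\<lambda>s. (1 - a) *\<^sub>R u s + a *\<^sub>R v s)"
      using z' y' B that by (subst input_map_combine[where T=T]) (auto simp flip: split)
    finally show ?thesis .
  qed
  moreover have "(1 - a) *\<^sub>R x T + a *\<^sub>R y T = xT"
    using z' y' by (simp flip: split)
  moreover have "(\<lambda>t. (1 - a) *\<^sub>R u t + a *\<^sub>R v t) \<in> U"
    using U a z' y' by (auto simp: convex_functions_def)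
  moreover have "(\<lambda>t. (1 - a) *\<^sub>R u t + a *\<^sub>R v t) \<in> L2 {0<..<T}"
    using z' y' by (intro L2_combine) auto
  moreover have "continuous_on {0..T} (\<lambda>t. (1 - a) *\<^sub>R x t + a *\<^sub>R y t)"
    using z' y' by (intro continuous_intros) auto
  ultimately show ?thesis by (simp add: admissible_pairs_def)
qed

end

section \<open>Convexity of the optimal control problem\<close>

text \<open>Representatives of the elements of the space \<open>X\<close>, before dynamics and
  constraints are imposed.\<close>

definition state_control_pairs ::
    "real \<Rightarrow> ((real \<Rightarrow> 'h::real_normed_vector) \<times> (real \<Rightarrow> 'u::real_normed_vector)) set" where
  "state_control_pairs T = {(x, u). continuous_on {0..T} x \<and> u \<in> L2 {0<..<T}}"

lemma norm_C_bdd_above: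
  fixes x :: "real \<Rightarrow> 'h::real_normed_vector"
  assumes "continuous_on {0..T} x"
  shows "bdd_above ((\<lambda>t. norm (x t)) ` {0..T})"
  using assms by (intro bounded_imp_bdd_above compact_imp_bounded compact_continuous_image
      continuous_on_norm) auto

lemma norm_C_ge:
  fixes x :: "real \<Rightarrow> 'h::real_normed_vector"
  assumes "continuous_on {0..T} x" "t \<in> {0..T}"
  shows "norm (x t) \<le> norm_C T x"
  unfolding norm_C_def using assms by (intro cSUP_upper norm_C_bdd_above)

lemma norm_C_nonneg:
  fixes x :: "real \<Rightarrow> 'h::real_normed_vector"
  assumes "continuous_on {0..T} x" "0 \<le> T"
  shows "0 \<le> norm_C T x"
  using norm_C_ge[OF assms(1), of 0] assms(2) norm_ge_zero[of "x 0"] by (simp del: norm_ge_zero)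

lemma norm_L2_nonneg: "0 \<le> norm_L2 T u"
  by (simp add: norm_L2_def integral_nonneg)

lemma norm_L2_eq_0_AE:
  fixes u :: "real \<Rightarrow> 'u::real_normed_vector"
  assumes "u \<in> L2 {0<..<T}" "norm_L2 T u = 0"
  shows "AE t in lebesgue_on {0<..<T}. u t = 0"
proof -
  have "integral\<^sup>L (lebesgue_on {0<..<T}) (\<lambda>t. (norm (u t))\<^sup>2) = 0"
    using assms(2) by (simp add: norm_L2_def)
  then have "AE t in lebesgue_on {0<..<T}. (norm (u t))\<^sup>2 = 0"
    using assms(1) by (subst (asm) integral_nonneg_eq_0_iff_AE) (auto simp: L2_def)
  then show ?thesis by simp
qed

lemma L2_diff:
  fixes u v :: "real \<Rightarrow> 'u::real_normed_vector"
  assumes "u \<in> L2 S" "v \<in> L2 S" "S \<in> sets lebesgue"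
  shows "(\<lambda>t. u t - v t) \<in> L2 S"
  using L2_combine[OF assms, of 1 "-1"] by simp

lemma dist_X_nonneg:
  assumes "0 \<le> T" "z \<in> state_control_pairs T" "y \<in> state_control_pairs T"
  shows "0 \<le> dist_X T y z"
  using assms
  by (auto simp: dist_X_def state_control_pairs_def intro!: add_nonneg_nonneg norm_C_nonneg
      norm_L2_nonneg continuous_on_diff)

lemma dist_X_eq_0:
  fixes x y :: "real \<Rightarrow> 'h::real_normed_vector" and u v :: "real \<Rightarrow> 'u::real_normed_vector"
  assumes T: "0 \<le> T" and z: "(x, u) \<in> state_control_pairs T" and y: "(y, v) \<in> state_control_pairs T"
    and d: "dist_X T (y, v) (x, u) = 0"
  shows "\<And>t. t \<in> {0..T} \<Longrightarrow> y t = x t" "AE t in lebesgue_on {0<..<T}. v t = u t"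
proof -
  have cont: "continuous_on {0..T} (\<lambda>t. y t - x t)" and L2: "(\<lambda>t. v t - u t) \<in> L2 {0<..<T}"
    using z y by (auto simp: state_control_pairs_def intro!: continuous_on_diff L2_diff)
  have "norm_C T (\<lambda>t. y t - x t) = 0" and 0: "norm_L2 T (\<lambda>t. v t - u t) = 0"
    using d norm_C_nonneg[OF cont T] norm_L2_nonneg[of T "\<lambda>t. v t - u t"] by (auto simp: dist_X_def)
  then show "y t = x t" if "t \<in> {0..T}" for t
    using norm_C_ge[OF cont that] by simp
  show "AE t in lebesgue_on {0<..<T}. v t = u t"
    using norm_L2_eq_0_AE[OF L2 0] by simp
qed

lemma dist_X_segment:
  fixes x y :: "real \<Rightarrow> 'h::real_normed_vector" and u v :: "real \<Rightarrow> 'u::real_normed_vector"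
  assumes T: "0 \<le> T" and z: "(x, u) \<in> state_control_pairs T" and y: "(y, v) \<in> state_control_pairs T"
    and a: "0 \<le> a"
  shows "dist_X T (\<lambda>t. (1 - a) *\<^sub>R x t + a *\<^sub>R y t, \<lambda>t. (1 - a) *\<^sub>R u t + a *\<^sub>R v t) (x, u)
    \<le> a * dist_X T (y, v) (x, u)"
proof -
  have cont: "continuous_on {0..T} (\<lambda>t. y t - x t)"
    using z y by (auto simp: state_control_pairs_def intro!: continuous_on_diff)
  have eq: "(1 - a) *\<^sub>R w + a *\<^sub>R w' - w = a *\<^sub>R (w' - w)" for w w' :: "'c::real_vector"
    by (simp add: algebra_simps)
  have "norm_C T (\<lambda>t. a *\<^sub>R (y t - x t)) \<le> a * norm_C T (\<lambda>t. y t - x t)"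
    unfolding norm_C_def[of T "\<lambda>t. a *\<^sub>R (y t - x t)"]
    using T a norm_C_ge[OF cont] by (intro cSUP_least) (auto intro: mult_left_mono)
  moreover have "norm_L2 T (\<lambda>t. a *\<^sub>R (v t - u t)) = a * norm_L2 T (\<lambda>t. v t - u t)"
    using a by (simp add: norm_L2_def power_mult_distrib real_sqrt_mult)
  ultimately show ?thesis by (simp add: dist_X_def eq distrib_left)
qed

text \<open>The witness on a segment is the pointwise convex combination. The hypothesis
  \<open>cong\<close> accounts for representatives: pairs at distance zero may differ outside
  \<open>{0..T}\<close> in the state and on a null set in the control.\<close>

lemma segmentwise_convexI:
  fixes f :: "(real \<Rightarrow> 'h::real_normed_vector) \<times> (real \<Rightarrow> 'u::real_normed_vector) \<Rightarrow> real"
  assumes T: "0 \<le> T" and K: "K \<subseteq> state_control_pairs T"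
    and seg: "\<And>x u y v a. (x, u) \<in> K \<Longrightarrow> (y, v) \<in> K \<Longrightarrow> 0 < a \<Longrightarrow> a < 1 \<Longrightarrow>
      (\<lambda>t. (1 - a) *\<^sub>R x t + a *\<^sub>R y t, \<lambda>t. (1 - a) *\<^sub>R u t + a *\<^sub>R v t) \<in> K"
    and conv: "\<And>x u y v a. (x, u) \<in> K \<Longrightarrow> (y, v) \<in> K \<Longrightarrow> 0 < a \<Longrightarrow> a < 1 \<Longrightarrow>
      f (\<lambda>t. (1 - a) *\<^sub>R x t + a *\<^sub>R y t, \<lambda>t. (1 - a) *\<^sub>R u t + a *\<^sub>R v t) \<le> (1 - a) * f (x, u) + a * f (y, v)"
    and cong: "\<And>x u y v. (x, u) \<in> K \<Longrightarrow> (y, v) \<in> K \<Longrightarrow> (\<And>t. t \<in> {0..T} \<Longrightarrow> y t = x t) \<Longrightarrow>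
      AE t in lebesgue_on {0<..<T}. v t = u t \<Longrightarrow> f (y, v) = f (x, u)"
  shows "segmentwise_convex (dist_X T) f K"
  unfolding segmentwise_convex_def
proof (intro ballI conjI allI impI)
  fix z y assume zK: "z \<in> K" and yK: "y \<in> K"
  obtain x u where z: "z = (x, u)" by (cases z)
  obtain y' v where y: "y = (y', v)" by (cases y)
  have z': "(x, u) \<in> state_control_pairs T" and y'': "(y', v) \<in> state_control_pairs T"
    using zK yK K z y by auto
  show "0 \<le> dist_X T y z"
    using T z' y'' unfolding z y by (rule dist_X_nonneg)
  show "f y = f z" if "dist_X T y z = 0"
    using cong[of x u y' v] dist_X_eq_0[OF T z' y''] zK yK that unfolding z y by blast
  fix a :: real assume a: "0 < a \<and> a < 1"
  then show "\<exists>w\<in>K. dist_X T w z \<le> a * dist_X T y z \<and> f w \<le> (1 - a) * f z + a * f y"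
    using seg[of x u y' v a] conv[of x u y' v a] dist_X_segment[OF T z' y'', of a] zK yK
    unfolding z y by (meson less_imp_le)
qed

section \<open>Integrability, convexity and well-definedness of the objective\<close>

locale integral_functional =
  fixes T :: real and \<theta> :: "'h::real_normed_vector \<Rightarrow> 'u::real_normed_vector \<Rightarrow> real \<Rightarrow> real"
  assumes horizon: "T > 0"
    and theta_continuous: "continuous_on (UNIV \<times> UNIV \<times> {0..T}) (\<lambda>(x, u, t). \<theta> x u t)"
    and theta_growth: "\<forall>R>0. \<exists>C>0. \<exists>\<omega>. integrable (lebesgue_on {0<..<T}) \<omega> \<and>
        (AE t in lebesgue_on {0<..<T}. \<omega> t \<ge> 0) \<and>
        (\<forall>x u. \<forall>t\<in>{0<..<T}. norm x \<le> R \<longrightarrow> \<bar>\<theta> x u t\<bar> \<le> C * (norm u)\<^sup>2 + \<omega> t)"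
    and theta_convex: "\<forall>t\<in>{0..T}. convex_on UNIV (\<lambda>(x, u). \<theta> x u t)"
begin

text \<open>The integrand is a Caratheodory function of time and control once the continuous state
  is inserted, and the growth condition dominates it because a continuous trajectory stays in a
  ball.\<close>

lemma integrand_integrable:
  assumes "(x, u) \<in> state_control_pairs T"
  shows "integrable (lebesgue_on {0<..<T}) (\<lambda>t. \<theta> (x t) (u t) t)"
proof -
  interpret complete_measure "lebesgue_on {0<..<T}" by (rule complete_measure_lebesgue_on) simp
  have x: "continuous_on {0..T} x" and u: "strongly_measurable (lebesgue_on {0<..<T}) u"
    and u2: "integrable (lebesgue_on {0<..<T}) (\<lambda>t. (norm (u t))\<^sup>2)"
    using assms by (auto simp: state_control_pairs_def L2_def)
  have x': "continuous_on {0<..<T} x" using x by (rule continuous_on_subset) auto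
  have meas: "(\<lambda>t. \<theta> (x t) (u t) t) \<in> borel_measurable (lebesgue_on {0<..<T})"
  proof (rule borel_measurable_Caratheodory[OF u])
    fix c
    have "continuous_on {0<..<T} ((\<lambda>(x, u, t). \<theta> x u t) \<circ> (\<lambda>t. (x t, c, t)))"
      using x'
      by (intro continuous_on_compose continuous_on_subset[OF theta_continuous] continuous_intros) auto
    then show "(\<lambda>t. \<theta> (x t) c t) \<in> borel_measurable (lebesgue_on {0<..<T})"
      by (intro continuous_imp_measurable_on_sets_lebesgue) (auto simp: o_def)
  next
    fix t assume "t \<in> space (lebesgue_on {0<..<T})"
    then have "continuous_on UNIV ((\<lambda>(x, u, t). \<theta> x u t) \<circ> (\<lambda>c. (x t, c, t)))"
      by (intro continuous_on_compose continuous_on_subset[OF theta_continuous] continuous_intros) auto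
    then show "continuous_on UNIV (\<lambda>c. \<theta> (x t) c t)" by (simp add: o_def)
  qed
  \<comment> \<open>The growth condition is available for positive radii only, and the trajectory
    may vanish.\<close>
  define R where "R = norm_C T x + 1"
  have "R > 0" using norm_C_nonneg[OF x] horizon by (simp add: R_def)
  then obtain C \<omega> where C: "C > 0" "integrable (lebesgue_on {0<..<T}) \<omega>"
    "AE t in lebesgue_on {0<..<T}. \<omega> t \<ge> 0"
    "\<And>x u t. t\<in>{0<..<T} \<Longrightarrow> norm x \<le> R \<Longrightarrow> \<bar>\<theta> x u t\<bar> \<le> C * (norm u)\<^sup>2 + \<omega> t"
    using theta_growth by meson
  show ?thesis
  proof (rule Bochner_Integration.integrable_bound[OF _ meas])
    show "integrable (lebesgue_on {0<..<T}) (\<lambda>t. C * (norm (u t))\<^sup>2 + \<omega> t)"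
      using u2 C by auto
    show "AE t in lebesgue_on {0<..<T}. norm (\<theta> (x t) (u t) t) \<le> norm (C * (norm (u t))\<^sup>2 + \<omega> t)"
    proof (rule AE_I2)
      fix t assume "t \<in> space (lebesgue_on {0<..<T})"
      then have t: "t \<in> {0<..<T}" by simp
      then have "norm (x t) \<le> R" using norm_C_ge[OF x, of t] by (simp add: R_def)
      then show "norm (\<theta> (x t) (u t) t) \<le> norm (C * (norm (u t))\<^sup>2 + \<omega> t)"
        using C(4)[OF t, of "x t" "u t"] by simp
    qed
  qed
qed

lemma objective_convex:
  assumes z: "(x, u) \<in> state_control_pairs T" and y: "(y, v) \<in> state_control_pairs T"
    and a: "0 \<le> a" "a \<le> 1"
  shows "objective T \<theta> (\<lambda>t. (1 - a) *\<^sub>R x t + a *\<^sub>R y t, \<lambda>t. (1 - a) *\<^sub>R u t + a *\<^sub>R v t) \<le>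
    (1 - a) * objective T \<theta> (x, u) + a * objective T \<theta> (y, v)"
proof -
  have w: "(\<lambda>t. (1 - a) *\<^sub>R x t + a *\<^sub>R y t, \<lambda>t. (1 - a) *\<^sub>R u t + a *\<^sub>R v t) \<in> state_control_pairs T"
    using z y by (auto simp: state_control_pairs_def intro!: continuous_intros L2_combine)
  note int = integrand_integrable[OF z] integrand_integrable[OF y] integrand_integrable[OF w]
  have "objective T \<theta> (\<lambda>t. (1 - a) *\<^sub>R x t + a *\<^sub>R y t, \<lambda>t. (1 - a) *\<^sub>R u t + a *\<^sub>R v t) \<le>
      (LINT t|lebesgue_on {0<..<T}. (1 - a) * \<theta> (x t) (u t) t + a * \<theta> (y t) (v t) t)"
    unfolding objective_def prod.case
  proof (rule integral_mono)
    fix t assume "t \<in> space (lebesgue_on {0<..<T})"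
    then have "convex_on UNIV (\<lambda>(x, u). \<theta> x u t)" using theta_convex by simp
    from convex_onD[OF this, of a "(x t, u t)" "(y t, v t)"] a
    show "\<theta> ((1 - a) *\<^sub>R x t + a *\<^sub>R y t) ((1 - a) *\<^sub>R u t + a *\<^sub>R v t) t \<le>
        (1 - a) * \<theta> (x t) (u t) t + a * \<theta> (y t) (v t) t" by simp
  qed (use int in auto)
  also have "\<dots> = (1 - a) * objective T \<theta> (x, u) + a * objective T \<theta> (y, v)"
    using int by (simp add: objective_def)
  finally show ?thesis .
qed

lemma objective_cong:
  assumes z: "(x, u) \<in> state_control_pairs T" and y: "(y, v) \<in> state_control_pairs T"
    and xy: "\<And>t. t \<in> {0..T} \<Longrightarrow> y t = x t" and uv: "AE t in lebesgue_on {0<..<T}. v t = u t"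
  shows "objective T \<theta> (y, v) = objective T \<theta> (x, u)"
  unfolding objective_def prod.case
proof (rule integral_cong_AE)
  show "AE t in lebesgue_on {0<..<T}. \<theta> (y t) (v t) t = \<theta> (x t) (u t) t"
    using uv AE_space by eventually_elim (simp add: xy)
qed (use integrand_integrable[OF z] integrand_integrable[OF y] in auto)

end

section \<open>The \<open>L\<^sup>p\<close> penalty and the Lagrange multipliers\<close>

text \<open>Convexity of the power function is invoked for positive arguments; if one argument
  vanishes, the claim is that \<open>b powr p\<close> is at most \<open>b\<close> for
  \<open>b\<close> in the unit interval.\<close>

lemma powr_convex_nonneg:
  fixes x y :: real
  assumes p: "p \<ge> 1" and xy: "0 \<le> x" "0 \<le> y" and a: "0 \<le> a" "0 \<le> b" "a + b = 1"
  shows "(a * x + b * y) powr p \<le> a * x powr p + b * y powr p"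
proof -
  have scale: "(b * y) powr p \<le> b * y powr p" if "0 \<le> y" "0 \<le> b" "b \<le> 1" for b y :: real
  proof (cases "b = 0")
    case False
    have "b powr p \<le> b powr 1" using that False p by (intro powr_mono') auto
    then show ?thesis using that False by (simp add: powr_mult mult_right_mono)
  qed simp
  consider "x = 0" | "y = 0" | "x > 0" "y > 0" using xy by linarith
  then show ?thesis
  proof cases
    case 1 then show ?thesis using scale[of y b] xy a by simp
  next
    case 2 then show ?thesis using scale[of x a] xy a by simp
  next
    case 3
    have "a = 1 - b" using a by simp
    then show ?thesis
      using convex_onD[OF powr_convex[OF p], of b x y] 3 a by (simp add: \<open>a = 1 - b\<close>)
  qed
qed

text \<open>There is no absolute value because only nonnegative functions are inserted. For the
  positive part of a constraint this is literally the corresponding summand of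
  \<open>penalty_function\<close>.\<close>

definition Lp_norm :: "real \<Rightarrow> 'a measure \<Rightarrow> ('a \<Rightarrow> real) \<Rightarrow> real" where
  "Lp_norm p M f = (LINT t|M. f t powr p) powr (1 / p)"

lemma Lp_norm_nonneg: "0 \<le> Lp_norm p M f"
  by (simp add: Lp_norm_def)

lemma Lp_norm_powr:
  assumes "p \<ge> 1"
  shows "Lp_norm p M f powr p = (LINT t|M. f t powr p)"
  using assms by (simp add: Lp_norm_def powr_powr integral_nonneg)

text \<open>Minkowski's inequality by normalisation: divided by a slight enlargement of its norm,
  each function has \<open>p\<close>-th power integral at most 1, and convexity of the power
  preserves this for convex combinations.\<close>

lemma Lp_norm_convex:
  assumes p: "p \<ge> 1"
    and f: "\<And>t. t \<in> space M \<Longrightarrow> 0 \<le> f t" "integrable M (\<lambda>t. f t powr p)"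
    and g: "\<And>t. t \<in> space M \<Longrightarrow> 0 \<le> g t" "integrable M (\<lambda>t. g t powr p)"
    and h: "\<And>t. t \<in> space M \<Longrightarrow> 0 \<le> h t" "integrable M (\<lambda>t. h t powr p)"
    and le: "\<And>t. t \<in> space M \<Longrightarrow> h t \<le> (1 - a) * f t + a * g t"
    and a: "0 \<le> a" "a \<le> 1"
  shows "Lp_norm p M h \<le> (1 - a) * Lp_norm p M f + a * Lp_norm p M g"
proof (rule field_le_epsilon)
  fix e :: real assume e: "0 < e"
  \<comment> \<open>The \<open>e\<close> keeps the normalising constants positive when a norm vanishes.\<close>
  define \<alpha> \<beta> where "\<alpha> = Lp_norm p M f + e" and "\<beta> = Lp_norm p M g + e"
  have pos: "\<alpha> > 0" "\<beta> > 0"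
    using e Lp_norm_nonneg[of p M f] Lp_norm_nonneg[of p M g] by (auto simp: \<alpha>_def \<beta>_def)
  define c where "c = (1 - a) * \<alpha> + a * \<beta>"
  have c: "c > 0"
  proof (cases "a = 0")
    case False
    then have "a * \<beta> > 0" using a pos by simp
    moreover have "(1 - a) * \<alpha> \<ge> 0" using a pos by simp
    ultimately show ?thesis by (simp add: c_def)
  qed (use pos in \<open>simp add: c_def\<close>)
  \<comment> \<open>With these weights, \<open>(1 - a) * f t + a * g t\<close> is \<open>c\<close>
    times a convex combination of \<open>f t / \<alpha>\<close> and \<open>g t / \<beta>\<close>,
    and \<open>c\<close> is the desired bound plus \<open>e\<close>.\<close>
  define v w where "v = (1 - a) * \<alpha> / c" and "w = a * \<beta> / c"
  have vw: "0 \<le> v" "0 \<le> w" "v + w = 1"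
    using a pos c by (auto simp: v_def w_def c_def simp flip: add_divide_distrib)
  have le_powr: "(LINT t|M. f t powr p) \<le> \<alpha> powr p" "(LINT t|M. g t powr p) \<le> \<beta> powr p"
    using p e Lp_norm_nonneg[of p M]
    by (auto simp: \<alpha>_def \<beta>_def Lp_norm_powr[OF p, symmetric] intro!: powr_mono2)
  have "(LINT t|M. h t powr p) \<le>
      (LINT t|M. c powr p * (v / \<alpha> powr p * f t powr p + w / \<beta> powr p * g t powr p))"
  proof (rule integral_mono)
    fix t assume t: "t \<in> space M"
    have "h t \<le> c * (v * (f t / \<alpha>) + w * (g t / \<beta>))"
      using le[OF t] pos c by (simp add: v_def w_def distrib_left)
    then have "h t powr p \<le> (c * (v * (f t / \<alpha>) + w * (g t / \<beta>))) powr p"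
      using h(1)[OF t] p by (intro powr_mono2) auto
    also have "\<dots> = c powr p * (v * (f t / \<alpha>) + w * (g t / \<beta>)) powr p"
      using c vw f(1)[OF t] g(1)[OF t] pos by (intro powr_mult)
    also have "\<dots> \<le> c powr p * (v * (f t / \<alpha>) powr p + w * (g t / \<beta>) powr p)"
      using vw f(1)[OF t] g(1)[OF t] pos by (intro mult_left_mono powr_convex_nonneg p) auto
    also have "\<dots> = c powr p * (v / \<alpha> powr p * f t powr p + w / \<beta> powr p * g t powr p)"
      using f(1)[OF t] g(1)[OF t] pos by (simp add: powr_divide)
    finally show "h t powr p \<le> \<dots>" .
  qed (use f g h in auto)
  also have "\<dots> = c powr p * (v * ((LINT t|M. f t powr p) / \<alpha> powr p) + w * ((LINT t|M. g t powr p) / \<beta> powr p))"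
    using f g by simp
  also have "\<dots> \<le> c powr p * (v * 1 + w * 1)"
    using le_powr pos vw by (intro mult_left_mono add_mono) auto
  also have "\<dots> = c powr p" using vw by simp
  finally have "(LINT t|M. h t powr p) powr (1 / p) \<le> (c powr p) powr (1 / p)"
    using p by (intro powr_mono2) (auto simp: integral_nonneg)
  also have "\<dots> = c" using c p by (simp add: powr_powr)
  finally show "Lp_norm p M h \<le> (1 - a) * Lp_norm p M f + a * Lp_norm p M g + e"
    by (simp add: Lp_norm_def[of p M h] c_def \<alpha>_def \<beta>_def algebra_simps)
qed

text \<open>The constant depends on \<open>h\<close> but not on \<open>f\<close>, so that one
  penalty weight can serve all trajectories. For \<open>p = 1\<close> it is an essential bound of
  \<open>h\<close>; otherwise Young's inequality is applied to normalised functions.\<close>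

lemma Holder_bound:
  fixes h :: "'a \<Rightarrow> real"
  assumes pq: "p \<ge> 1" "1 / ennreal p + 1 / q = 1"
    and h: "mem_Lp q M h" "\<And>t. 0 \<le> h t"
  obtains C where "0 \<le> C"
    "\<And>f. (\<And>t. t \<in> space M \<Longrightarrow> 0 \<le> f t) \<Longrightarrow> integrable M (\<lambda>t. f t powr p) \<Longrightarrow>
       integrable M (\<lambda>t. h t * f t) \<Longrightarrow> (LINT t|M. h t * f t) \<le> C * Lp_norm p M f"
proof (cases "p = 1")
  case True
  then have "1 / q = 0" using pq(2) by simp
  then have "q = \<infinity>" by (simp add: ennreal_divide_eq_0_iff)
  then obtain C where C: "AE t in M. \<bar>h t\<bar> \<le> C" using h by (auto simp: mem_Lp_def)
  show thesis
  proof (rule that[of "\<bar>C\<bar>"])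
    fix f assume f: "\<And>t. t \<in> space M \<Longrightarrow> 0 \<le> f t" "integrable M (\<lambda>t. f t powr p)"
      "integrable M (\<lambda>t. h t * f t)"
    have fi: "integrable M f"
      using f(1,2) True by (simp cong: Bochner_Integration.integrable_cong)
    have "(LINT t|M. h t * f t) \<le> (LINT t|M. \<bar>C\<bar> * f t)"
    proof (rule integral_mono_AE)
      show "AE t in M. h t * f t \<le> \<bar>C\<bar> * f t"
        using C AE_space by eventually_elim (auto intro!: mult_right_mono f(1))
    qed (use f fi in auto)
    also have "\<dots> = \<bar>C\<bar> * Lp_norm p M f"
      using f(1) True by (simp add: Lp_norm_def integral_nonneg cong: Bochner_Integration.integral_cong)
    finally show "(LINT t|M. h t * f t) \<le> \<bar>C\<bar> * Lp_norm p M f" .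
  qed simp
next
  case False
  then have p1: "p > 1" using pq by simp
  have "q \<noteq> \<infinity>"
  proof
    assume "q = \<infinity>"
    then have "1 / ennreal p = ennreal 1" using pq(2) by simp
    then show False using p1 by (simp add: divide_ennreal flip: ennreal_1)
  qed
  moreover have "q \<noteq> 0"
  proof
    assume "q = 0"
    then have "1 / q = \<infinity>" by (simp add: ennreal_divide_zero)
    then show False using pq(2) by simp
  qed
  ultimately obtain r where r: "q = ennreal r" "r > 0"
    by (cases q) (auto simp: order_le_less)
  have "ennreal (1 / p + 1 / r) = ennreal 1"
    using pq(2) p1 r by (simp add: divide_ennreal flip: ennreal_1 ennreal_plus)
  then have conj: "1 / p + 1 / r = 1" using p1 r by (subst (asm) ennreal_inj) auto
  moreover have "1 / p > 0" using p1 by simp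
  ultimately have "1 / r < 1" by linarith
  then have r1: "r > 1" using r by simp
  have hr: "integrable M (\<lambda>t. h t powr r)"
    using h(1) r unfolding mem_Lp_def by (simp add: abs_of_nonneg[OF h(2)])
  \<comment> \<open>Adding 1 allows division by \<open>\<beta>\<close> even if \<open>h\<close>
    vanishes almost everywhere; the constant need not be sharp.\<close>
  define \<beta> where "\<beta> = Lp_norm r M h + 1"
  have \<beta>: "\<beta> > 0" using Lp_norm_nonneg[of r M h] by (simp add: \<beta>_def)
  show thesis
  proof (rule that[of \<beta>])
    fix f assume f: "\<And>t. t \<in> space M \<Longrightarrow> 0 \<le> f t" "integrable M (\<lambda>t. f t powr p)"
      "integrable M (\<lambda>t. h t * f t)"
    show "(LINT t|M. h t * f t) \<le> \<beta> * Lp_norm p M f"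
    proof (rule field_le_epsilon)
      fix e :: real assume e: "0 < e"
      \<comment> \<open>Dividing \<open>e\<close> by \<open>\<beta>\<close> makes the final product
        \<open>\<alpha> * \<beta>\<close> exceed the bound by exactly \<open>e\<close>.\<close>
      define \<alpha> where "\<alpha> = Lp_norm p M f + e / \<beta>"
      have \<alpha>: "\<alpha> > 0" using e \<beta> Lp_norm_nonneg[of p M f] by (simp add: \<alpha>_def add_nonneg_pos)
      have le_powr: "(LINT t|M. f t powr p) \<le> \<alpha> powr p" "(LINT t|M. h t powr r) \<le> \<beta> powr r"
        using p1 r1 e \<beta> Lp_norm_nonneg[of p M f] Lp_norm_nonneg[of r M h]
        by (auto simp: \<alpha>_def \<beta>_def Lp_norm_powr[of p M f, symmetric] Lp_norm_powr[of r M h, symmetric]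
            intro!: powr_mono2)
      have "(LINT t|M. h t * f t) \<le>
          (LINT t|M. \<alpha> * \<beta> * (f t powr p / (p * \<alpha> powr p) + h t powr r / (r * \<beta> powr r)))"
      proof (rule integral_mono)
        fix t assume t: "t \<in> space M"
        have "f t / \<alpha> * (h t / \<beta>) \<le> (f t / \<alpha>) powr p / p + (h t / \<beta>) powr r / r"
          using p1 r1 conj f(1)[OF t] h(2)[of t] \<alpha> \<beta> by (intro Youngs_inequality) auto
        also have "\<dots> = f t powr p / (p * \<alpha> powr p) + h t powr r / (r * \<beta> powr r)"
          using f(1)[OF t] h(2)[of t] \<alpha> \<beta> by (simp add: powr_divide mult.commute)
        finally have "\<alpha> * \<beta> * (f t / \<alpha> * (h t / \<beta>)) \<le>
            \<alpha> * \<beta> * (f t powr p / (p * \<alpha> powr p) + h t powr r / (r * \<beta> powr r))"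
          using \<alpha> \<beta> by (intro mult_left_mono) auto
        then show "h t * f t \<le> \<alpha> * \<beta> * (f t powr p / (p * \<alpha> powr p) + h t powr r / (r * \<beta> powr r))"
          using \<alpha> \<beta> by (simp add: mult.commute)
      qed (use f hr in auto)
      also have "\<dots> = \<alpha> * \<beta> * ((LINT t|M. f t powr p) / \<alpha> powr p * (1 / p) +
          (LINT t|M. h t powr r) / \<beta> powr r * (1 / r))"
        using f hr by (simp add: mult.commute)
      also have "\<dots> \<le> \<alpha> * \<beta> * (1 * (1 / p) + 1 * (1 / r))"
        using le_powr \<alpha> \<beta> p1 r1 by (intro mult_left_mono add_mono mult_right_mono) auto
      also have "\<dots> = \<alpha> * \<beta>" using conj by simp
      also have "\<dots> = \<beta> * Lp_norm p M f + e" using \<beta> by (simp add: \<alpha>_def field_simps)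
      finally show "(LINT t|M. h t * f t) \<le> \<beta> * Lp_norm p M f + e" .
    qed
  qed (use \<beta> in simp)
qed

text \<open>Penalties live on the open interval with Lebesgue measure, multiplier densities on the
  closed interval with \<open>lborel\<close>. The gauge integral links the two for continuous
  functions.\<close>

lemma continuous_on_integrals:
  fixes f :: "real \<Rightarrow> real"
  assumes f: "continuous_on {0..T} f"
  shows "integrable (lebesgue_on {0<..<T}) f"
    and "(LINT t|lebesgue_on {0<..<T}. f t) = integral {0..T} f"
    and "integrable (restrict_space lborel {0..T}) f"
    and "(LINT t|restrict_space lborel {0..T}. f t) = integral {0..T} f"
proof -
  have "integrable (lebesgue_on {0..T}) f"
    using f by (intro continuous_imp_integrable_real)
  then show i: "integrable (lebesgue_on {0<..<T}) f"
    by (rule integrable_lebesgue_on_subset) (auto intro: greaterThanLessThan_subseteq_atLeastAtMost_iff[THEN iffD2])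
  show "(LINT t|lebesgue_on {0<..<T}. f t) = integral {0..T} f"
    using lebesgue_integral_eq_integral[OF i] by (simp add: integral_open_interval_real)
  have s: "set_integrable lborel {0..T} f" by (rule borel_integrable_atLeastAtMost'[OF f])
  then show "integrable (restrict_space lborel {0..T}) f"
    by (simp add: integrable_restrict_space set_integrable_def)
  show "(LINT t|restrict_space lborel {0..T}. f t) = integral {0..T} f"
    using set_borel_integral_eq_integral(2)[OF s]
    by (simp add: integral_restrict_space set_lebesgue_integral_def)
qed

text \<open>Against a nonnegative density, replacing \<open>f\<close> by its positive part can only
  increase the integral; Hoelder's inequality then bounds it by the penalty term.\<close>

lemma multiplier_bound:
  fixes \<mu> :: "real measure"
  assumes \<mu>: "regular_borel_measure_on {0..T} \<mu>"
    and ac: "absolutely_continuous (restrict_space lborel {0..T}) \<mu>"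
    and Lp: "mem_Lp p' (restrict_space lborel {0..T})
             (\<lambda>t. enn2real (RN_deriv (restrict_space lborel {0..T}) \<mu> t))"
    and p: "p \<ge> 1" "1 / ennreal p + 1 / p' = 1"
  obtains C where "0 \<le> C" "\<And>f. continuous_on {0..T} f \<Longrightarrow>
    (LINT t|\<mu>. f t) \<le> C * Lp_norm p (lebesgue_on {0<..<T}) (\<lambda>t. max (f t) 0)"
proof -
  define N where "N = restrict_space lborel {0..T}"
  define h where "h t = enn2real (RN_deriv N \<mu> t)" for t
  have spN: "space N = {0..T}" by (simp add: N_def space_restrict_space)
  interpret \<mu>: finite_measure \<mu> using \<mu> by (simp add: regular_borel_measure_on_def)
  have sets: "sets \<mu> = sets N"
    using \<mu> by (simp add: regular_borel_measure_on_def N_def sets_restrict_space)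
  interpret N: finite_measure N
    by (rule finite_measureI) (simp add: N_def emeasure_restrict_space space_restrict_space emeasure_lborel_Icc_eq)
  have [measurable]: "h \<in> borel_measurable N" unfolding h_def by measurable
  \<comment> \<open>The conversion \<open>enn2real\<close> would send infinite values of the
    derivative to 0, so almost everywhere finiteness is needed to recover \<open>\<mu>\<close> from
    the real density \<open>h\<close>.\<close>
  have "AE t in N. RN_deriv N \<mu> t \<noteq> \<infinity>"
    using \<mu>.sigma_finite_measure_axioms ac sets unfolding N_def[symmetric] by (rule N.RN_deriv_finite)
  then have "AE t in N. RN_deriv N \<mu> t = ennreal (h t)"
    by eventually_elim (simp add: h_def less_top)
  then have "density N (RN_deriv N \<mu>) = density N (\<lambda>t. ennreal (h t))"
    by (intro density_cong) auto
  then have dens: "\<mu> = density N (\<lambda>t. ennreal (h t))"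
    using N.density_RN_deriv[of \<mu>] ac sets by (simp add: N_def)
  have h0: "0 \<le> h t" for t by (simp add: h_def)
  \<comment> \<open>The integral of the density is the total mass of the finite measure
    \<open>\<mu>\<close>.\<close>
  have hi: "integrable N h"
  proof (rule integrableI_nonneg)
    have "(\<integral>\<^sup>+t. ennreal (h t) \<partial>N) = emeasure \<mu> (space \<mu>)"
      by (subst (2) dens) (simp add: emeasure_density dens cong: nn_integral_cong_simp)
    then show "(\<integral>\<^sup>+t. ennreal (h t) \<partial>N) < \<infinity>" by (simp add: less_top[symmetric])
  qed (use h0 in auto)
  have hf: "integrable N (\<lambda>t. h t * f t)" if f: "continuous_on {0..T} f" for f :: "real \<Rightarrow> real"
  proof -
    have [measurable]: "f \<in> borel_measurable N"
      using continuous_on_integrals(3)[OF f] unfolding N_def by (rule borel_measurable_integrable)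
    obtain b where b: "\<forall>t\<in>{0..T}. \<bar>f t\<bar> \<le> b"
      using compact_imp_bounded[OF compact_continuous_image[OF f]] by (auto simp: bounded_iff)
    show ?thesis
    proof (rule Bochner_Integration.integrable_bound)
      show "integrable N (\<lambda>t. \<bar>b\<bar> * h t)" using hi by simp
      show "AE t in N. norm (h t * f t) \<le> norm (\<bar>b\<bar> * h t)"
      proof (rule AE_I2)
        fix t assume "t \<in> space N"
        then have "\<bar>f t\<bar> \<le> \<bar>b\<bar>" using b by (force simp: spN)
        then show "norm (h t * f t) \<le> norm (\<bar>b\<bar> * h t)"
          using mult_right_mono[of "\<bar>f t\<bar>" "\<bar>b\<bar>" "h t"] h0[of t] by (simp add: abs_mult mult.commute)
      qed
    qed measurable
  qed
  obtain C where C: "0 \<le> C"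
    "\<And>f. (\<And>t. t \<in> space N \<Longrightarrow> 0 \<le> f t) \<Longrightarrow> integrable N (\<lambda>t. f t powr p) \<Longrightarrow>
       integrable N (\<lambda>t. h t * f t) \<Longrightarrow> (LINT t|N. h t * f t) \<le> C * Lp_norm p N f"
    using Holder_bound[OF p Lp] h0 unfolding N_def[symmetric] h_def[symmetric] by metis
  show thesis
  proof (rule that[OF C(1)])
    fix f :: "real \<Rightarrow> real" assume f: "continuous_on {0..T} f"
    have f': "continuous_on {0..T} (\<lambda>t. max (f t) 0)" using f by (intro continuous_intros)
    have fp: "continuous_on {0..T} (\<lambda>t. max (f t) 0 powr p)"
      using f p by (intro continuous_on_powr' continuous_intros) auto
    have [measurable]: "f \<in> borel_measurable N"
      using continuous_on_integrals(3)[OF f] unfolding N_def by (rule borel_measurable_integrable)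
    have "(LINT t|\<mu>. f t) = (LINT t|N. h t * f t)"
      using h0 by (subst dens, subst integral_density) auto
    also have "\<dots> \<le> (LINT t|N. h t * max (f t) 0)"
      using h0 by (intro integral_mono hf f f') (auto intro: mult_left_mono)
    also have "\<dots> \<le> C * Lp_norm p N (\<lambda>t. max (f t) 0)"
      using continuous_on_integrals(3)[OF fp] hf[OF f'] by (intro C(2)) (auto simp: N_def)
    also have "Lp_norm p N (\<lambda>t. max (f t) 0) = Lp_norm p (lebesgue_on {0<..<T}) (\<lambda>t. max (f t) 0)"
      by (simp add: Lp_norm_def N_def continuous_on_integrals(2,4)[OF fp])
    finally show "(LINT t|\<mu>. f t) \<le> C * Lp_norm p (lebesgue_on {0<..<T}) (\<lambda>t. max (f t) 0)" .
  qed
qed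

section \<open>State constraints along a trajectory\<close>

lemma continuous_on_along_trajectory:
  assumes "continuous_on (UNIV \<times> {0..T}) (\<lambda>(x, t). g x t)" "continuous_on {0..T} x"
  shows "continuous_on {0..T} (\<lambda>t. g (x t) t)"
proof -
  have "continuous_on {0..T} ((\<lambda>(x, t). g x t) \<circ> (\<lambda>t. (x t, t)))"
    using assms by (intro continuous_on_compose continuous_intros) (auto elim: continuous_on_subset)
  then show ?thesis by (simp add: o_def)
qed

lemma integrable_positive_part_powr:
  fixes f :: "real \<Rightarrow> real"
  assumes "continuous_on {0..T} f" "p \<ge> 1"
  shows "continuous_on {0..T} (\<lambda>t. max (f t) 0 powr p)"
    and "integrable (lebesgue_on {0<..<T}) (\<lambda>t. max (f t) 0 powr p)"
proof -
  show c: "continuous_on {0..T} (\<lambda>t. max (f t) 0 powr p)"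
    using assms by (intro continuous_on_powr' continuous_intros) auto
  show "integrable (lebesgue_on {0<..<T}) (\<lambda>t. max (f t) 0 powr p)"
    using c by (rule continuous_on_integrals(1))
qed

text \<open>A nonnegative continuous function with zero integral over a nondegenerate interval
  vanishes identically. So the integral penalty detects a violation at a single instant, even at an
  endpoint.\<close>

lemma Lp_norm_positive_part_pos:
  fixes f :: "real \<Rightarrow> real"
  assumes T: "0 < T" and f: "continuous_on {0..T} f" and p: "p \<ge> 1" and t: "t \<in> {0..T}" "0 < f t"
  shows "0 < Lp_norm p (lebesgue_on {0<..<T}) (\<lambda>t. max (f t) 0)"
proof -
  note c = integrable_positive_part_powr(1)[OF f p]
  have "integral {0..T} (\<lambda>t. max (f t) 0 powr p) \<noteq> 0"
    using t by (subst integral_eq_0_iff[OF c T]) (auto intro!: bexI[of _ t])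
  then show ?thesis
    by (simp add: Lp_norm_def continuous_on_integrals(2)[OF c])
qed

text \<open>The positive part is increasing and convex, so it preserves convexity of
  \<open>g\<close> in the state, and Minkowski's inequality does the rest.\<close>

lemma Lp_norm_positive_part_convex:
  fixes x y :: "real \<Rightarrow> 'h::real_normed_vector"
  assumes g: "continuous_on (UNIV \<times> {0..T}) (\<lambda>(x, t). g x t)" "\<forall>t\<in>{0..T}. convex_on UNIV (\<lambda>x. g x t)"
    and xy: "continuous_on {0..T} x" "continuous_on {0..T} y" and p: "p \<ge> 1" and a: "0 \<le> a" "a \<le> 1"
  shows "Lp_norm p (lebesgue_on {0<..<T}) (\<lambda>t. max (g ((1 - a) *\<^sub>R x t + a *\<^sub>R y t) t) 0) \<le>
    (1 - a) * Lp_norm p (lebesgue_on {0<..<T}) (\<lambda>t. max (g (x t) t) 0) +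
    a * Lp_norm p (lebesgue_on {0<..<T}) (\<lambda>t. max (g (y t) t) 0)"
proof (rule Lp_norm_convex[OF p])
  have w: "continuous_on {0..T} (\<lambda>t. (1 - a) *\<^sub>R x t + a *\<^sub>R y t)"
    using xy by (intro continuous_intros)
  note integrable_positive_part_powr(2)[OF continuous_on_along_trajectory[OF g(1)] p]
  then show "integrable (lebesgue_on {0<..<T}) (\<lambda>t. max (g (x t) t) 0 powr p)"
    "integrable (lebesgue_on {0<..<T}) (\<lambda>t. max (g (y t) t) 0 powr p)"
    "integrable (lebesgue_on {0<..<T}) (\<lambda>t. max (g ((1 - a) *\<^sub>R x t + a *\<^sub>R y t) t) 0 powr p)"
    using xy w by blast+
  fix t assume "t \<in> space (lebesgue_on {0<..<T})"
  then have "convex_on UNIV (\<lambda>x. g x t)" using g(2) by simp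
  from convex_onD[OF this a, of "x t" "y t"]
  have "g ((1 - a) *\<^sub>R x t + a *\<^sub>R y t) t \<le> (1 - a) * g (x t) t + a * g (y t) t" by simp
  also have "\<dots> \<le> (1 - a) * max (g (x t) t) 0 + a * max (g (y t) t) 0"
    using a by (intro add_mono mult_left_mono) auto
  finally show "max (g ((1 - a) *\<^sub>R x t + a *\<^sub>R y t) t) 0 \<le>
      (1 - a) * max (g (x t) t) 0 + a * max (g (y t) t) 0"
    using a by simp
qed (use a in auto)

theorem theorem15:
  fixes S :: "real \<Rightarrow> 'h::complex_hilbert \<Rightarrow> 'h"
    and \<beta> :: complex
    and \<iota> :: "'h \<Rightarrow> 'e::complex_banach"
    and B :: "'u::complex_hilbert \<Rightarrow> 'e"
    and T :: real
    and x0 xT :: 'h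
    and U :: "(real \<Rightarrow> 'u) set"
    and \<theta> :: "'h \<Rightarrow> 'u \<Rightarrow> real \<Rightarrow> real"
    and l :: nat
    and g :: "nat \<Rightarrow> 'h \<Rightarrow> real \<Rightarrow> real"
    and p :: real
    and p' :: ennreal
    and zs :: "(real \<Rightarrow> 'h) \<times> (real \<Rightarrow> 'u)"
    and A \<Omega> :: "((real \<Rightarrow> 'h) \<times> (real \<Rightarrow> 'u)) set"
  assumes A_def: "A = admissible_pairs S \<iota> B T x0 xT U"
    and Omega_def: "\<Omega> = feasible_pairs T l g A"
    and semigroup: "C0_semigroup S"
    and extrapolation: "extrapolation_space S \<beta> \<iota>"
    and control: "admissible_control S \<iota> B"
    and horizon: "T > 0"
    and controls: "U \<subseteq> L2 {0<..<T}" "closed_L2 T U" "convex_functions U"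
    and theta_continuous: "continuous_on (UNIV \<times> UNIV \<times> {0..T}) (\<lambda>(x, u, t). \<theta> x u t)"
    and theta_growth: "\<forall>R>0. \<exists>C>0. \<exists>\<omega>. integrable (lebesgue_on {0<..<T}) \<omega> \<and>
        (AE t in lebesgue_on {0<..<T}. \<omega> t \<ge> 0) \<and>
        (\<forall>x u. \<forall>t\<in>{0<..<T}. norm x \<le> R \<longrightarrow> \<bar>\<theta> x u t\<bar> \<le> C * (norm u)\<^sup>2 + \<omega> t)"
    and optimal: "zs \<in> global_solutions (objective T \<theta>) \<Omega>"
    and g_convex: "\<forall>j\<in>{1..l}. \<forall>t\<in>{0..T}. convex_on UNIV (\<lambda>x. g j x t)"
    and g_continuous: "\<forall>j\<in>{1..l}. continuous_on (UNIV \<times> {0..T}) (\<lambda>(x, t). g j x t)"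
    and slater: "\<exists>(x, u)\<in>A. \<forall>t\<in>{0..T}. \<forall>j\<in>{1..l}. g j (x t) t < 0"
    and theta_convex: "\<forall>t\<in>{0..T}. convex_on UNIV (\<lambda>(x, u). \<theta> x u t)"
    and exponents: "p \<ge> 1" "1 / ennreal p + 1 / p' = 1"
    and multipliers: "\<exists>\<mu>. lagrange_multipliers T \<theta> l g A zs \<mu> \<and>
        (\<forall>j\<in>{1..l}. absolutely_continuous (restrict_space lborel {0..T}) (\<mu> j) \<and>
           mem_Lp p' (restrict_space lborel {0..T})
             (\<lambda>t. enn2real (RN_deriv (restrict_space lborel {0..T}) (\<mu> j) t)))"
  shows "\<exists>c0\<ge>0. \<forall>c\<ge>c0.
           completely_exact (dist_X T) (objective T \<theta>) \<Omega> (penalty_function T \<theta> l g p c) A"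
  proof -
  interpret extrapolated_semigroup S \<beta> \<iota>
    using semigroup extrapolation by unfold_locales
  interpret integral_functional T \<theta>
    using horizon theta_continuous theta_growth theta_convex by unfold_locales
  have B: "bounded_linear B"
    using control by (simp add: admissible_control_def bounded_clinear_def)
  have A_pairs: "A \<subseteq> state_control_pairs T"
    by (auto simp: A_def admissible_pairs_def state_control_pairs_def)
  have \<Omega>_A: "\<Omega> \<subseteq> A"
    by (auto simp: Omega_def feasible_pairs_def)
  have cont: "continuous_on {0..T} x" if "(x, u) \<in> A" for x u
    using that A_pairs by (auto simp: state_control_pairs_def)
  have g_cont: "continuous_on {0..T} (\<lambda>t. g j (x t) t)" if "(x, u) \<in> A" "j \<in> {1..l}" for x u j
    using g_continuous that(2) cont[OF that(1)] by (blast intro: continuous_on_along_trajectory)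
  have seg_A: "(\<lambda>t. (1 - a) *\<^sub>R x t + a *\<^sub>R y t, \<lambda>t. (1 - a) *\<^sub>R u t + a *\<^sub>R v t) \<in> A"
    if "(x, u) \<in> A" "(y, v) \<in> A" "0 < a" "a < 1" for x u y v a
    using that unfolding A_def by (intro admissible_pairs_convex[OF B controls(3)]) auto
  have seg_\<Omega>: "(\<lambda>t. (1 - a) *\<^sub>R x t + a *\<^sub>R y t, \<lambda>t. (1 - a) *\<^sub>R u t + a *\<^sub>R v t) \<in> \<Omega>"
    if z: "(x, u) \<in> \<Omega>" and y: "(y, v) \<in> \<Omega>" and a: "0 < a" "a < 1" for x u y v a
  proof -
    have "g j ((1 - a) *\<^sub>R x t + a *\<^sub>R y t) t \<le> 0" if tj: "t \<in> {0..T}" "j \<in> {1..l}" for t j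
    proof -
      have "convex_on UNIV (\<lambda>x. g j x t)" using g_convex tj by blast
      from convex_onD[OF this, of a "x t" "y t"] a
      have "g j ((1 - a) *\<^sub>R x t + a *\<^sub>R y t) t \<le> (1 - a) * g j (x t) t + a * g j (y t) t" by simp
      moreover have "g j (x t) t \<le> 0" "g j (y t) t \<le> 0"
        using z y tj by (auto simp: Omega_def feasible_pairs_def)
      ultimately show ?thesis
        using a mult_nonneg_nonpos[of "1 - a" "g j (x t) t"] mult_nonneg_nonpos[of a "g j (y t) t"]
        by linarith
    qed
    then show ?thesis
      using seg_A[of x u y v a] z y a \<Omega>_A by (auto simp: Omega_def feasible_pairs_def)
  qed
  let ?N = "\<lambda>j x. Lp_norm p (lebesgue_on {0<..<T}) (\<lambda>t. max (g j (x t) t) 0)"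
  have penalty: "penalty_function T \<theta> l g p c (x, u) = objective T \<theta> (x, u) + c * (\<Sum>j=1..l. ?N j x)"
    for c x u
    by (simp add: penalty_function_def Lp_norm_def)

  obtain \<mu> where \<mu>: "lagrange_multipliers T \<theta> l g A zs \<mu>"
    "\<forall>j\<in>{1..l}. absolutely_continuous (restrict_space lborel {0..T}) (\<mu> j) \<and>
       mem_Lp p' (restrict_space lborel {0..T})
         (\<lambda>t. enn2real (RN_deriv (restrict_space lborel {0..T}) (\<mu> j) t))"
    using multipliers by blast
  have "\<exists>C\<ge>0. \<forall>f. continuous_on {0..T} f \<longrightarrow>
      (LINT t|\<mu> j. f t) \<le> C * Lp_norm p (lebesgue_on {0<..<T}) (\<lambda>t. max (f t) 0)" if j: "j \<in> {1..l}" for j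
  proof -
    have "regular_borel_measure_on {0..T} (\<mu> j)"
      using \<mu>(1) j by (simp add: lagrange_multipliers_def)
    then show ?thesis
    proof (rule multiplier_bound[OF _ _ _ exponents])
      show "absolutely_continuous (restrict_space lborel {0..T}) (\<mu> j)"
        "mem_Lp p' (restrict_space lborel {0..T})
          (\<lambda>t. enn2real (RN_deriv (restrict_space lborel {0..T}) (\<mu> j) t))"
        using \<mu>(2) j by auto
    qed blast
  qed
  then obtain C where C: "\<And>j. j \<in> {1..l} \<Longrightarrow> C j \<ge> 0"
    "\<And>j f. j \<in> {1..l} \<Longrightarrow> continuous_on {0..T} f \<Longrightarrow>
      (LINT t|\<mu> j. f t) \<le> C j * Lp_norm p (lebesgue_on {0<..<T}) (\<lambda>t. max (f t) 0)"
    by metis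
  \<comment> \<open>The penalty has one common weight, so a common upper bound of the nonnegative
    \<open>C j\<close> is taken.\<close>
  define c0 where "c0 = (\<Sum>j=1..l. C j)"
  have c0: "0 \<le> c0" unfolding c0_def using C(1) by (intro sum_nonneg)
  have C_le: "C j \<le> c0" if "j \<in> {1..l}" for j
    unfolding c0_def using that C(1) by (intro member_le_sum) auto
  \<comment> \<open>This is a nonstrict bound on all of \<open>A\<close>, not yet enough to rule out
    infeasible minimizers.\<close>
  have lower: "objective T \<theta> zs \<le> objective T \<theta> (x, u) + c0 * (\<Sum>j=1..l. ?N j x)"
    if z: "(x, u) \<in> A" for x u
  proof -
    have "(\<Sum>j=1..l. LINT t|\<mu> j. g j (x t) t) \<le> (\<Sum>j=1..l. c0 * ?N j x)"
    proof (rule sum_mono)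
      fix j assume j: "j \<in> {1..l}"
      have "(LINT t|\<mu> j. g j (x t) t) \<le> C j * ?N j x" using C(2)[OF j g_cont[OF z j]] .
      also have "\<dots> \<le> c0 * ?N j x" by (intro mult_right_mono C_le j Lp_norm_nonneg)
      finally show "(LINT t|\<mu> j. g j (x t) t) \<le> c0 * ?N j x" .
    qed
    moreover have "objective T \<theta> zs \<le> objective T \<theta> (x, u) + (\<Sum>j=1..l. LINT t|\<mu> j. g j (x t) t)"
      using \<mu>(1) z unfolding lagrange_multipliers_def by blast
    ultimately show ?thesis by (simp add: sum_distrib_left)
  qed

  show ?thesis
  proof (intro exI[of _ "c0 + 1"] conjI allI impI)
    show "0 \<le> c0 + 1" using c0 by simp
    fix c assume c: "c0 + 1 \<le> c"
    show "completely_exact (dist_X T) (objective T \<theta>) \<Omega> (penalty_function T \<theta> l g p c) A"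
    proof (rule completely_exactI[OF \<Omega>_A _ _ _ optimal])
      fix z assume z: "z \<in> \<Omega>"
      obtain x u where xu: "z = (x, u)" by (cases z)
      have "?N j x = 0" if j: "j \<in> {1..l}" for j
      proof -
        have "(LINT t|lebesgue_on {0<..<T}. max (g j (x t) t) 0 powr p) = (LINT t|lebesgue_on {0<..<T}. 0)"
        proof (rule Bochner_Integration.integral_cong[OF refl])
          fix t assume "t \<in> space (lebesgue_on {0<..<T})"
          then have "g j (x t) t \<le> 0"
            using z j unfolding xu Omega_def feasible_pairs_def by auto
          then show "max (g j (x t) t) 0 powr p = 0" by simp
        qed
        then show ?thesis by (simp add: Lp_norm_def)
      qed
      then show "penalty_function T \<theta> l g p c z = objective T \<theta> z"
        unfolding xu penalty by simp
    next
      show "segmentwise_convex (dist_X T) (objective T \<theta>) \<Omega>"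
        using seg_\<Omega> horizon \<Omega>_A A_pairs
        by (intro segmentwise_convexI) (auto intro!: objective_convex objective_cong)
    next
      show "segmentwise_convex (dist_X T) (penalty_function T \<theta> l g p c) A"
      proof (rule segmentwise_convexI[OF _ A_pairs seg_A])
        fix x u y v and a :: real
        assume z: "(x, u) \<in> A" and y: "(y, v) \<in> A" and a: "0 < a" "a < 1"
        let ?w = "\<lambda>t. (1 - a) *\<^sub>R x t + a *\<^sub>R y t"
        have "(\<Sum>j=1..l. ?N j ?w) \<le> (\<Sum>j=1..l. (1 - a) * ?N j x + a * ?N j y)"
          using g_continuous g_convex cont[OF z] cont[OF y] exponents(1) a
          by (intro sum_mono Lp_norm_positive_part_convex) auto
        also have "\<dots> = (1 - a) * (\<Sum>j=1..l. ?N j x) + a * (\<Sum>j=1..l. ?N j y)"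
          by (simp add: sum.distrib sum_distrib_left)
        finally have "c * (\<Sum>j=1..l. ?N j ?w) \<le> c * ((1 - a) * (\<Sum>j=1..l. ?N j x) + a * (\<Sum>j=1..l. ?N j y))"
          using c c0 by (intro mult_left_mono) auto
        moreover have "objective T \<theta> (?w, \<lambda>t. (1 - a) *\<^sub>R u t + a *\<^sub>R v t) \<le>
            (1 - a) * objective T \<theta> (x, u) + a * objective T \<theta> (y, v)"
          using z y A_pairs a by (intro objective_convex) auto
        ultimately show "penalty_function T \<theta> l g p c (?w, \<lambda>t. (1 - a) *\<^sub>R u t + a *\<^sub>R v t) \<le>
            (1 - a) * penalty_function T \<theta> l g p c (x, u) + a * penalty_function T \<theta> l g p c (y, v)"
          unfolding penalty by (simp add: algebra_simps)
      next
        fix x u y v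
        assume z: "(x, u) \<in> A" and y: "(y, v) \<in> A" and xy: "\<And>t. t \<in> {0..T} \<Longrightarrow> y t = x t"
          and uv: "AE t in lebesgue_on {0<..<T}. v t = u t"
        have "?N j y = ?N j x" for j
          unfolding Lp_norm_def using xy
          by (intro arg_cong2[where f="(powr)"] Bochner_Integration.integral_cong refl) auto
        moreover have "objective T \<theta> (y, v) = objective T \<theta> (x, u)"
          using z y A_pairs xy uv by (intro objective_cong) auto
        ultimately show "penalty_function T \<theta> l g p c (y, v) = penalty_function T \<theta> l g p c (x, u)"
          unfolding penalty by simp
      qed (use horizon in auto)
    next
      fix z assume "z \<in> A - \<Omega>"
      then obtain x u where z: "z = (x, u)" "(x, u) \<in> A" "(x, u) \<notin> \<Omega>" by (cases z) auto
      then obtain j t where j: "j \<in> {1..l}" and t: "t \<in> {0..T}" "0 < g j (x t) t"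
        by (auto simp: Omega_def feasible_pairs_def not_le)
      have "0 < ?N j x"
        using horizon g_cont[OF z(2) j] exponents(1) t by (rule Lp_norm_positive_part_pos)
      also have "\<dots> \<le> (\<Sum>j=1..l. ?N j x)"
        using j by (intro member_le_sum Lp_norm_nonneg) auto
      \<comment> \<open>Both factors of strictness meet here: the weight exceeds \<open>c0\<close>,
        and the penalty of an infeasible pair is positive.\<close>
      finally have "c0 * (\<Sum>j=1..l. ?N j x) < c * (\<Sum>j=1..l. ?N j x)"
        using c by (intro mult_strict_right_mono) auto
      then show "objective T \<theta> zs < penalty_function T \<theta> l g p c z"
        using lower[OF z(2)] unfolding z(1) penalty by linarith
    qed
  qed
qed

end
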